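(* Let $(\mathfrak{g},\theta)$ be a finite-dimensional real symmetric Lie algebra, and let $\mathfrak{g}^{*}$ be its dual real form. Then there exist an algebraic family of complex Lie algebras $\boldsymbol{\mathfrak{g}}$ over $\mathbb{A}^{1}_{\mathbb{C}}$ and an anti-holomorphic involution $\boldsymbol{\sigma}:\boldsymbol{\mathfrak{g}}\to\boldsymbol{\mathfrak{g}}$ such that, for every $\alpha\in\mathbb{R}$, the fiber over $\alpha$ of the family of real Lie algebras $\boldsymbol{\mathfrak{g}}^{\boldsymbol{\sigma}}=\{X\in\boldsymbol{\mathfrak{g}}:\boldsymbol{\sigma}(X)=X\}$ satisfies, as a real Lie algebra, $$\boldsymbol{\mathfrak{g}}^{\boldsymbol{\sigma}}|_{\alpha}\cong\begin{cases}\mathfrak{g}^{*}, & \alpha<0,\\ \mathfrak{g}^{\theta}\ltimes\mathfrak{g}^{-\theta}, & \alpha=0,\\ \mathfrak{g}, & \alpha>0.\end{cases}$$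
   Context: A real symmetric Lie algebra is a pair $(\mathfrak{g},\theta)$ where $\mathfrak{g}$ is a real Lie algebra and $\theta$ is an involutive automorphism of $\mathfrak{g}$. Put $\mathfrak{g}^{\pm\theta}=\{X\in\mathfrak{g}:\theta(X)=\pm X\}$, so $\mathfrak{g}=\mathfrak{g}^{\theta}\oplus\mathfrak{g}^{-\theta}$. Dual real form: let $\mathfrak{g}(\mathbb{C})=\mathbb{C}\otimes_{\mathbb{R}}\mathfrak{g}$, let $\widetilde{\theta}$ be the complex-linear extension of $\theta$ to $\mathfrak{g}(\mathbb{C})$, and let $\sigma$ be the conjugate-linear involution of $\mathfrak{g}(\mathbb{C})$ that is the identity on $\mathfrak{g}=1\otimes\mathfrak{g}$. Set $\sigma^{*}=\sigma\widetilde{\theta}$ and $\mathfrak{g}^{*}=\mathfrak{g}(\mathbb{C})^{\sigma^{*}}=\{X\in\mathfrak{g}(\mathbb{C}):\sigma^{*}(X)=X\}$, a real Lie algebra; as a subspace of $\mathfrak{g}(\mathbb{C})$ it equals $\mathfrak{g}^{\theta}\oplus i\mathfrak{g}^{-\theta}$. The Lie algebra $\mathfrak{g}^{\theta}\ltimes\mathfrak{g}^{-\theta}$ is the semidirect product in which $\mathfrak{g}^{-\theta}$ is an abelian ideal, $\mathfrak{g}^{\theta}$ is a subalgebra with its original bracket, and for $X\in\mathfrak{g}^{\theta}$, $Y\in\mathfrak{g}^{-\theta}$ the mixed bracket is the bracket $[X,Y]\in\mathfrak{g}^{-\theta}$ of $\mathfrak{g}$. An algebraic family of complex Lie algebras over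 $\mathbb{A}^{1}_{\mathbb{C}}$ is a finite-rank free $\mathbb{C}[z]$-module $\boldsymbol{\mathfrak{g}}$ equipped with the structure of a Lie algebra over the ring $\mathbb{C}[z]$. An algebraic family of real Lie algebras over $\mathbb{A}^{1}_{\mathbb{R}}$ is a finite-rank free $\mathbb{R}[z]$-module $\boldsymbol{\mathfrak{l}}$ equipped with the structure of a Lie algebra over $\mathbb{R}[z]$; its fiber over $\alpha\in\mathbb{R}$ is the real Lie algebra $\boldsymbol{\mathfrak{l}}|_{\alpha}=\boldsymbol{\mathfrak{l}}/(z-\alpha)\boldsymbol{\mathfrak{l}}$ (using $\mathbb{R}[z]/(z-\alpha)\cong\mathbb{R}$). An anti-holomorphic involution of an algebraic family $\boldsymbol{\mathfrak{g}}$ of complex Lie algebras over $\mathbb{A}^{1}_{\mathbb{C}}$ is a morphism $\boldsymbol{\sigma}:\boldsymbol{\mathfrak{g}}\to\boldsymbol{\mathfrak{g}}$ of Lie algebras over $\mathbb{R}[z]$ with $\boldsymbol{\sigma}^{2}=\mathrm{id}$ and $\boldsymbol{\sigma}(f(z)X)=\overline{f}(z)\boldsymbol{\sigma}(X)$ for all $X\in\boldsymbol{\mathfrak{g}}$, $f\in\mathbb{C}[z]$, where $\overline{f}(z)=\sum_{j}\overline{a_{j}}z^{j}$ if $f(z)=\sum_{j}a_{j}z^{j}$. The fixed-point set $\boldsymbol{\mathfrak{g}}^{\boldsymbol{\sigma}}$ is an algebraic family of real Lie algebras over $\mathbb{A}^{1}_{\mathbb{R}}$. *)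

theory Defs
  imports
    "HOL-Algebra.Module"
    "HOL-Algebra.QuotRing"
    "HOL-Algebra.Algebraic_Closure_Type"
    "HOL-Computational_Algebra.Polynomial"
    Complex_Main
begin

text \<open>
  A Lie algebra over a commutative ring is a \<^typ>\<open>('r, 'a) module\<close> record whose \<open>mult\<close> field
  is the bracket: \<open>x \<otimes>\<^bsub>L\<^esub> y\<close> is [x, y]. The field \<open>one\<close> has no meaning and is never used.
  The scalars are always a full type, turned into a ring record by \<^const>\<open>ring_of_type_algebra\<close>;
  C[z] and R[z] are \<^typ>\<open>complex poly\<close> and \<^typ>\<open>real poly\<close>.
\<close>

abbreviation scalars :: "'r::comm_ring_1 ring" where
  "scalars \<equiv> ring_of_type_algebra"

locale lie_algebra = Module.module scalars L
  for L :: "('r::comm_ring_1, 'a) module" (structure) +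
  assumes bracket_closed: "\<lbrakk>x \<in> carrier L; y \<in> carrier L\<rbrakk> \<Longrightarrow> x \<otimes> y \<in> carrier L"
    and bracket_add_left: "\<lbrakk>x \<in> carrier L; y \<in> carrier L; z \<in> carrier L\<rbrakk> \<Longrightarrow>
      (x \<oplus> y) \<otimes> z = (x \<otimes> z) \<oplus> (y \<otimes> z)"
    and bracket_add_right: "\<lbrakk>x \<in> carrier L; y \<in> carrier L; z \<in> carrier L\<rbrakk> \<Longrightarrow>
      x \<otimes> (y \<oplus> z) = (x \<otimes> y) \<oplus> (x \<otimes> z)"
    and bracket_smult_left: "\<lbrakk>x \<in> carrier L; y \<in> carrier L\<rbrakk> \<Longrightarrow>
      (c \<odot> x) \<otimes> y = c \<odot> (x \<otimes> y)"
    and bracket_smult_right: "\<lbrakk>x \<in> carrier L; y \<in> carrier L\<rbrakk> \<Longrightarrow>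
      x \<otimes> (c \<odot> y) = c \<odot> (x \<otimes> y)"
    and bracket_self: "x \<in> carrier L \<Longrightarrow> x \<otimes> x = \<zero>"
    and jacobi: "\<lbrakk>x \<in> carrier L; y \<in> carrier L; z \<in> carrier L\<rbrakk> \<Longrightarrow>
      (x \<otimes> (y \<otimes> z)) \<oplus> (y \<otimes> (z \<otimes> x)) \<oplus> (z \<otimes> (x \<otimes> y)) = \<zero>"

definition lie_hom ::
  "('r::comm_ring_1, 'a) module \<Rightarrow> ('r, 'b) module \<Rightarrow> ('a \<Rightarrow> 'b) \<Rightarrow> bool" where
  "lie_hom L M \<phi> \<longleftrightarrow>
     \<phi> \<in> carrier L \<rightarrow> carrier M \<and>
     (\<forall>x\<in>carrier L. \<forall>y\<in>carrier L. \<phi> (x \<oplus>\<^bsub>L\<^esub> y) = \<phi> x \<oplus>\<^bsub>M\<^esub> \<phi> y) \<and>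
     (\<forall>c. \<forall>x\<in>carrier L. \<phi> (c \<odot>\<^bsub>L\<^esub> x) = c \<odot>\<^bsub>M\<^esub> \<phi> x) \<and>
     (\<forall>x\<in>carrier L. \<forall>y\<in>carrier L. \<phi> (x \<otimes>\<^bsub>L\<^esub> y) = \<phi> x \<otimes>\<^bsub>M\<^esub> \<phi> y)"

definition lie_iso ::
  "('r::comm_ring_1, 'a) module \<Rightarrow> ('r, 'b) module \<Rightarrow> ('a \<Rightarrow> 'b) \<Rightarrow> bool" where
  "lie_iso L M \<phi> \<longleftrightarrow> lie_hom L M \<phi> \<and> bij_betw \<phi> (carrier L) (carrier M)"

definition lie_isomorphic ::
  "('r::comm_ring_1, 'a) module \<Rightarrow> ('r, 'b) module \<Rightarrow> bool" where
  "lie_isomorphic L M \<longleftrightarrow> (\<exists>\<phi>. lie_iso L M \<phi>)"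

text \<open>Over a field this is finite-dimensionality.\<close>

definition finite_free :: "('r::comm_ring_1, 'a) module \<Rightarrow> bool" where
  "finite_free M \<longleftrightarrow>
     (\<exists>B. finite B \<and> B \<subseteq> carrier M \<and>
        (\<forall>x\<in>carrier M. \<exists>!c. c \<in> B \<rightarrow>\<^sub>E UNIV \<and> x = (\<Oplus>\<^bsub>M\<^esub>b\<in>B. c b \<odot>\<^bsub>M\<^esub> b)))"

definition restrict_scalars :: "('s \<Rightarrow> 'r) \<Rightarrow> ('r, 'a) module \<Rightarrow> ('s, 'a) module" where
  "restrict_scalars h L =
     \<lparr>carrier = carrier L, monoid.mult = monoid.mult L, one = one L, zero = zero L, add = add L,
      module.smult = (\<lambda>c x. h c \<odot>\<^bsub>L\<^esub> x)\<rparr>"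

definition fixed_subalgebra :: "('r, 'a) module \<Rightarrow> ('a \<Rightarrow> 'a) \<Rightarrow> ('r, 'a) module" where
  "fixed_subalgebra L s = L\<lparr>carrier := {x \<in> carrier L. s x = x}\<rparr>"


section \<open>Symmetric Lie algebras\<close>

definition symmetric_lie_algebra :: "(real, 'a) module \<Rightarrow> ('a \<Rightarrow> 'a) \<Rightarrow> bool" where
  "symmetric_lie_algebra g \<theta> \<longleftrightarrow>
     lie_algebra g \<and> lie_iso g g \<theta> \<and> (\<forall>x\<in>carrier g. \<theta> (\<theta> x) = x)"

definition anti_fixed :: "(real, 'a) module \<Rightarrow> ('a \<Rightarrow> 'a) \<Rightarrow> 'a set" where
  "anti_fixed g \<theta> = {x \<in> carrier g. \<theta> x = \<ominus>\<^bsub>g\<^esub> x}"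

text \<open>
  The tensor product of C with g over R, in the standard model given by the real basis 1, i of C:
  the pair \<open>(x, y)\<close> stands for 1 \<otimes> x + i \<otimes> y.
\<close>

definition complexification :: "(real, 'a) module \<Rightarrow> (complex, 'a \<times> 'a) module" where
  "complexification g =
     \<lparr>carrier = carrier g \<times> carrier g,
      monoid.mult = (\<lambda>(x, y) (x', y').
        ((x \<otimes>\<^bsub>g\<^esub> x') \<ominus>\<^bsub>g\<^esub> (y \<otimes>\<^bsub>g\<^esub> y'), (x \<otimes>\<^bsub>g\<^esub> y') \<oplus>\<^bsub>g\<^esub> (y \<otimes>\<^bsub>g\<^esub> x'))),
      one = undefined,
      zero = (\<zero>\<^bsub>g\<^esub>, \<zero>\<^bsub>g\<^esub>),
      add = (\<lambda>(x, y) (x', y'). (x \<oplus>\<^bsub>g\<^esub> x', y \<oplus>\<^bsub>g\<^esub> y')),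
      module.smult = (\<lambda>c (x, y).
        ((Re c \<odot>\<^bsub>g\<^esub> x) \<ominus>\<^bsub>g\<^esub> (Im c \<odot>\<^bsub>g\<^esub> y), (Re c \<odot>\<^bsub>g\<^esub> y) \<oplus>\<^bsub>g\<^esub> (Im c \<odot>\<^bsub>g\<^esub> x)))\<rparr>"

definition complex_linear_extension :: "('a \<Rightarrow> 'a) \<Rightarrow> 'a \<times> 'a \<Rightarrow> 'a \<times> 'a" where
  "complex_linear_extension \<theta> = (\<lambda>(x, y). (\<theta> x, \<theta> y))"

definition conjugation :: "(real, 'a) module \<Rightarrow> 'a \<times> 'a \<Rightarrow> 'a \<times> 'a" where
  "conjugation g = (\<lambda>(x, y). (x, \<ominus>\<^bsub>g\<^esub> y))"

definition dual_real_form :: "(real, 'a) module \<Rightarrow> ('a \<Rightarrow> 'a) \<Rightarrow> (real, 'a \<times> 'a) module" where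
  "dual_real_form g \<theta> =
     fixed_subalgebra (restrict_scalars complex_of_real (complexification g))
       (conjugation g \<circ> complex_linear_extension \<theta>)"

text \<open>
  The bracket below is the one determined bilinearly and antisymmetrically by
  [(X, 0), (X', 0)] = ([X, X'], 0), [(X, 0), (0, Y)] = (0, [X, Y]) and [(0, Y), (0, Y')] = 0.
\<close>

definition symmetric_semidirect ::
  "(real, 'a) module \<Rightarrow> ('a \<Rightarrow> 'a) \<Rightarrow> (real, 'a \<times> 'a) module" where
  "symmetric_semidirect g \<theta> =
     \<lparr>carrier = carrier (fixed_subalgebra g \<theta>) \<times> anti_fixed g \<theta>,
      monoid.mult = (\<lambda>(x, y) (x', y').
        (x \<otimes>\<^bsub>g\<^esub> x', (x \<otimes>\<^bsub>g\<^esub> y') \<ominus>\<^bsub>g\<^esub> (x' \<otimes>\<^bsub>g\<^esub> y))),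
      one = undefined,
      zero = (\<zero>\<^bsub>g\<^esub>, \<zero>\<^bsub>g\<^esub>),
      add = (\<lambda>(x, y) (x', y'). (x \<oplus>\<^bsub>g\<^esub> x', y \<oplus>\<^bsub>g\<^esub> y')),
      module.smult = (\<lambda>c (x, y). (c \<odot>\<^bsub>g\<^esub> x, c \<odot>\<^bsub>g\<^esub> y))\<rparr>"


section \<open>Algebraic families over the affine line\<close>

text \<open>\<open>'k\<close> is \<^typ>\<open>complex\<close> or \<^typ>\<open>real\<close>.\<close>

definition algebraic_family :: "('k::field poly, 'a) module \<Rightarrow> bool" where
  "algebraic_family G \<longleftrightarrow> lie_algebra G \<and> finite_free G"

definition antiholomorphic_involution :: "(complex poly, 'a) module \<Rightarrow> ('a \<Rightarrow> 'a) \<Rightarrow> bool" where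
  "antiholomorphic_involution G \<sigma> \<longleftrightarrow>
     lie_hom (restrict_scalars (map_poly complex_of_real) G)
       (restrict_scalars (map_poly complex_of_real) G) \<sigma> \<and>
     (\<forall>x\<in>carrier G. \<sigma> (\<sigma> x) = x) \<and>
     (\<forall>f. \<forall>x\<in>carrier G. \<sigma> (f \<odot>\<^bsub>G\<^esub> x) = map_poly cnj f \<odot>\<^bsub>G\<^esub> \<sigma> x)"

definition real_family :: "(complex poly, 'a) module \<Rightarrow> ('a \<Rightarrow> 'a) \<Rightarrow> (real poly, 'a) module" where
  "real_family G \<sigma> = fixed_subalgebra (restrict_scalars (map_poly complex_of_real) G) \<sigma>"

text \<open>
  The quotient of L by (z - \<open>\<alpha>\<close>)L, with elements the cosets. R[z]/(z - \<open>\<alpha>\<close>) is identified with R through constant polynomials, and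
  the union in \<open>smult\<close> is over representatives, as in \<^const>\<open>rcoset_mult\<close>: it is a single coset.
\<close>

definition fiber_ideal :: "(real poly, 'a) module \<Rightarrow> real \<Rightarrow> 'a set" where
  "fiber_ideal L \<alpha> = (\<lambda>x. [:- \<alpha>, 1:] \<odot>\<^bsub>L\<^esub> x) ` carrier L"

definition fiber :: "(real poly, 'a) module \<Rightarrow> real \<Rightarrow> (real, 'a set) module" where
  "fiber L \<alpha> =
     \<lparr>carrier = a_rcosets\<^bsub>L\<^esub> (fiber_ideal L \<alpha>),
      monoid.mult = rcoset_mult L (fiber_ideal L \<alpha>),
      one = undefined,
      zero = fiber_ideal L \<alpha>,
      add = set_add L,
      module.smult = (\<lambda>c A. \<Union>x\<in>A. fiber_ideal L \<alpha> +>\<^bsub>L\<^esub> ([:c:] \<odot>\<^bsub>L\<^esub> x))\<rparr>"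

end

theory Submission
  imports Defs
begin

text \<open>
  Let \<open>P\<close> be the projection of \<open>g\<close> onto the (-1)-eigenspace of \<open>\<theta>\<close>. The family carries the bracket
  \<open>[x, y] + (z - 1) [P x, P y]\<close>, which multiplies the brackets of two odd elements by \<open>z\<close> and is
  written in an arbitrary basis of \<open>g\<close>, so that its structure constants are real polynomials in \<open>z\<close>.
  At \<open>z = \<alpha> \<noteq> 0\<close>, rescaling the odd part by \<open>sqrt \<bar>\<alpha>\<bar>\<close> identifies the result with \<open>g\<close> or with its
  dual real form, according to the sign of \<open>\<alpha>\<close>. The Jacobi identity need only be checked at
  \<open>\<alpha> > 0\<close>, where it is inherited from \<open>g\<close>, because it is polynomial in \<open>z\<close>.
\<close>

text \<open>The rescaling needs a square root of \<alpha>, and z has none in R[z]. It therefore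
  gives no isomorphism over R[z], and all comparisons with \<open>g\<close> are made at one real
  parameter at a time. The factor is forced: scaling odd elements by c multiplies their mutual
  brackets by c^2, and c^2 = \<alpha> has a real solution for \<alpha> > 0 and an imaginary one for
  \<alpha> < 0. The imaginary one leads into the even part plus i times the odd part, which is the
  dual real form. At \<alpha> = 0 the odd part becomes abelian without any rescaling. Writing the
  bracket through P avoids a basis adapted to the eigenspaces, so whatever basis finite freeness
  supplies will do. Because the structure constants are real, coefficientwise conjugation of C[z]^n
  respects the bracket, and its fixed points are R[z]^n with the same constants. Evaluating
  coordinates at \<alpha> treats every fiber alike; the sign of \<alpha> enters only
  afterwards.\<close>

lemma scalars_simps [simp]:
  "carrier (scalars :: 'r::comm_ring_1 ring) = UNIV"
  "x \<oplus>\<^bsub>scalars\<^esub> y = x + y" "x \<otimes>\<^bsub>scalars\<^esub> y = x * y"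
  "\<one>\<^bsub>scalars\<^esub> = 1" "\<zero>\<^bsub>scalars\<^esub> = 0"
  by (simp_all add: ring_of_type_algebra_def)

lemma scalars_uminus [simp]: "\<ominus>\<^bsub>scalars\<^esub> x = - (x :: 'r::comm_ring_1)"
proof -
  interpret cring "scalars :: 'r ring" by rule
  have "- x \<oplus>\<^bsub>scalars\<^esub> x = \<zero>\<^bsub>scalars\<^esub>" by simp
  then show ?thesis by (simp only: minus_equality scalars_simps UNIV_I)
qed

section \<open>Isomorphisms, and maps out of a fiber\<close>

lemma lie_isomorphic_trans:
  assumes "lie_isomorphic L M" "lie_isomorphic M N"
  shows "lie_isomorphic L N"
proof -
  obtain \<phi> \<psi> where "lie_iso L M \<phi>" "lie_iso M N \<psi>"
    using assms by (auto simp: lie_isomorphic_def)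
  then have "lie_iso L N (\<psi> \<circ> \<phi>)"
    by (auto simp: lie_iso_def lie_hom_def Pi_iff intro: bij_betw_trans)
  then show ?thesis
    by (auto simp: lie_isomorphic_def)
qed

text \<open>The first isomorphism theorem in the shape that evaluation at \<alpha> calls for. By
  \<open>kernel\<close> the cosets are the level sets of \<open>\<psi>\<close>, so a coset can be
  sent to the one value that \<open>\<psi>\<close> takes on it, and the setwise operations of the
  fiber turn into operations on values.\<close>

lemma fiber_isomorphicI:
  assumes \<psi>: "\<psi> \<in> carrier L \<rightarrow> carrier M" "\<psi> ` carrier L = carrier M"
    and add: "\<And>x y. x \<in> carrier L \<Longrightarrow> y \<in> carrier L \<Longrightarrow> \<psi> (x \<oplus>\<^bsub>L\<^esub> y) = \<psi> x \<oplus>\<^bsub>M\<^esub> \<psi> y"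
    and smult: "\<And>c x. x \<in> carrier L \<Longrightarrow> \<psi> ([:c:] \<odot>\<^bsub>L\<^esub> x) = c \<odot>\<^bsub>M\<^esub> \<psi> x"
    and bracket: "\<And>x y. x \<in> carrier L \<Longrightarrow> y \<in> carrier L \<Longrightarrow> \<psi> (x \<otimes>\<^bsub>L\<^esub> y) = \<psi> x \<otimes>\<^bsub>M\<^esub> \<psi> y"
    and closed: "\<And>x y. x \<in> carrier L \<Longrightarrow> y \<in> carrier L \<Longrightarrow> x \<otimes>\<^bsub>L\<^esub> y \<in> carrier L"
      "\<And>c x. x \<in> carrier L \<Longrightarrow> [:c:] \<odot>\<^bsub>L\<^esub> x \<in> carrier L"
    and kernel: "\<And>y. y \<in> carrier L \<Longrightarrow>
      fiber_ideal L \<alpha> +>\<^bsub>L\<^esub> y = {x \<in> carrier L. \<psi> x = \<psi> y}"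
  shows "lie_isomorphic (fiber L \<alpha>) M"
proof -
  let ?\<Phi> = "\<lambda>A. the_elem (\<psi> ` A)"
  have coset: "\<exists>x\<in>carrier L. A = {y \<in> carrier L. \<psi> y = \<psi> x}" if "A \<in> carrier (fiber L \<alpha>)" for A
    using that kernel by (auto simp: fiber_def A_RCOSETS_def')
  have \<Phi>_eq: "?\<Phi> A = m" if "A \<noteq> {}" "\<And>y. y \<in> A \<Longrightarrow> \<psi> y = m" for A m
  proof -
    have "\<psi> ` A = {m}" using that by auto
    then show ?thesis by simp
  qed
  have \<Phi>: "?\<Phi> {y \<in> carrier L. \<psi> y = \<psi> x} = \<psi> x" if "x \<in> carrier L" for x
    by (rule \<Phi>_eq) (use that in auto)
  have "lie_hom (fiber L \<alpha>) M ?\<Phi>"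
    unfolding lie_hom_def
  proof (intro conjI ballI allI)
    show "?\<Phi> \<in> carrier (fiber L \<alpha>) \<rightarrow> carrier M"
      using coset \<Phi> \<psi>(1) by fastforce
  next
    fix A B assume "A \<in> carrier (fiber L \<alpha>)" "B \<in> carrier (fiber L \<alpha>)"
    then obtain x y where x: "x \<in> carrier L" "A = {z \<in> carrier L. \<psi> z = \<psi> x}"
      and y: "y \<in> carrier L" "B = {z \<in> carrier L. \<psi> z = \<psi> y}"
      using coset by blast
    show "?\<Phi> (A \<oplus>\<^bsub>fiber L \<alpha>\<^esub> B) = ?\<Phi> A \<oplus>\<^bsub>M\<^esub> ?\<Phi> B"
      unfolding x(2) y(2) \<Phi>[OF x(1)] \<Phi>[OF y(1)]
      by (rule \<Phi>_eq) (use x(1) y(1) in \<open>auto simp: fiber_def set_add_def' add\<close>)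
    show "?\<Phi> (A \<otimes>\<^bsub>fiber L \<alpha>\<^esub> B) = ?\<Phi> A \<otimes>\<^bsub>M\<^esub> ?\<Phi> B"
      unfolding x(2) y(2) \<Phi>[OF x(1)] \<Phi>[OF y(1)]
    proof (rule \<Phi>_eq)
      \<comment> \<open>\<open>rcoset_mult\<close> is a union over representatives. By
        \<open>bracket\<close> all the level sets in this union belong to the same value, so
        \<open>\<psi>\<close> is constant on it.\<close>
      have prod: "A \<otimes>\<^bsub>fiber L \<alpha>\<^esub> B = (\<Union>a\<in>A. \<Union>b\<in>B. {z \<in> carrier L. \<psi> z = \<psi> (a \<otimes>\<^bsub>L\<^esub> b)})"
        unfolding fiber_def rcoset_mult_def x(2) y(2) by (simp add: kernel closed(1))
      show "{z \<in> carrier L. \<psi> z = \<psi> x} \<otimes>\<^bsub>fiber L \<alpha>\<^esub> {z \<in> carrier L. \<psi> z = \<psi> y} \<noteq> {}"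
        using x y closed(1)[of x y] prod by blast
      show "\<psi> z = \<psi> x \<otimes>\<^bsub>M\<^esub> \<psi> y"
        if z: "z \<in> {z \<in> carrier L. \<psi> z = \<psi> x} \<otimes>\<^bsub>fiber L \<alpha>\<^esub> {z \<in> carrier L. \<psi> z = \<psi> y}" for z
      proof -
        obtain a b where "a \<in> A" "b \<in> B" "\<psi> z = \<psi> (a \<otimes>\<^bsub>L\<^esub> b)"
          using z unfolding prod[unfolded x(2) y(2)] x(2) y(2) by fast
        then show ?thesis
          using bracket[of a b] x(2) y(2) by simp
      qed
    qed
  next
    fix c A assume "A \<in> carrier (fiber L \<alpha>)"
    then obtain x where x: "x \<in> carrier L" "A = {z \<in> carrier L. \<psi> z = \<psi> x}"
      using coset by blast
    show "?\<Phi> (c \<odot>\<^bsub>fiber L \<alpha>\<^esub> A) = c \<odot>\<^bsub>M\<^esub> ?\<Phi> A"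
      unfolding x(2) \<Phi>[OF x(1)]
    proof (rule \<Phi>_eq)
      have smul: "c \<odot>\<^bsub>fiber L \<alpha>\<^esub> A = (\<Union>a\<in>A. {z \<in> carrier L. \<psi> z = \<psi> ([:c:] \<odot>\<^bsub>L\<^esub> a)})"
        unfolding fiber_def x(2) by (simp add: kernel closed(2))
      show "c \<odot>\<^bsub>fiber L \<alpha>\<^esub> {z \<in> carrier L. \<psi> z = \<psi> x} \<noteq> {}"
        using x closed(2)[of x c] smul by blast
      show "\<psi> z = c \<odot>\<^bsub>M\<^esub> \<psi> x" if z: "z \<in> c \<odot>\<^bsub>fiber L \<alpha>\<^esub> {z \<in> carrier L. \<psi> z = \<psi> x}" for z
      proof -
        obtain a where "a \<in> A" "\<psi> z = \<psi> ([:c:] \<odot>\<^bsub>L\<^esub> a)"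
          using z unfolding smul[unfolded x(2)] x(2) by fast
        then show ?thesis
          using smult[of a c] x(2) by simp
      qed
    qed
  qed
  moreover have "bij_betw ?\<Phi> (carrier (fiber L \<alpha>)) (carrier M)"
  proof (rule bij_betwI')
    fix A B assume "A \<in> carrier (fiber L \<alpha>)" "B \<in> carrier (fiber L \<alpha>)"
    then obtain x y where "x \<in> carrier L" "A = {z \<in> carrier L. \<psi> z = \<psi> x}"
      "y \<in> carrier L" "B = {z \<in> carrier L. \<psi> z = \<psi> y}"
      using coset by blast
    then show "?\<Phi> A = ?\<Phi> B \<longleftrightarrow> A = B"
      using \<Phi> by auto
  next
    fix A assume "A \<in> carrier (fiber L \<alpha>)"
    then show "?\<Phi> A \<in> carrier M"
      using coset \<Phi> \<psi>(1) by fastforce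
  next
    fix m assume "m \<in> carrier M"
    then obtain x where x: "x \<in> carrier L" "m = \<psi> x"
      using \<psi>(2) by auto
    then have "{y \<in> carrier L. \<psi> y = \<psi> x} \<in> carrier (fiber L \<alpha>)"
      using kernel by (auto simp: fiber_def A_RCOSETS_def')
    then show "\<exists>A\<in>carrier (fiber L \<alpha>). m = ?\<Phi> A"
      using x \<Phi> by metis
  qed
  ultimately show ?thesis
    by (auto simp: lie_isomorphic_def lie_iso_def)
qed


section \<open>Lie algebras from structure constants\<close>

text \<open>\<open>s i j k\<close> is the k-th coordinate of the bracket of the i-th and j-th basis
  vectors, and the last clause is the m-th coordinate of the Jacobi identity. The vanishing diagonal
  is listed beside antisymmetry because 2 may be a zero divisor in the ring.\<close>

definition structure_constants :: "nat \<Rightarrow> (nat \<Rightarrow> nat \<Rightarrow> nat \<Rightarrow> 'r::comm_ring_1) \<Rightarrow> bool" where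
  "structure_constants n s \<longleftrightarrow>
     (\<forall>i<n. \<forall>k<n. s i i k = 0) \<and> (\<forall>i<n. \<forall>j<n. \<forall>k<n. s i j k = - s j i k) \<and>
     (\<forall>i<n. \<forall>j<n. \<forall>k<n. \<forall>m<n.
        (\<Sum>l<n. s j k l * s i l m) + (\<Sum>l<n. s k i l * s j l m) + (\<Sum>l<n. s i j l * s k l m) = 0)"

lemma structure_constantsD:
  assumes "structure_constants n s" "i < n" "j < n" "k < n"
  shows "s i i k = 0" "s i j k = - s j i k"
    "m < n \<Longrightarrow>
      (\<Sum>l<n. s j k l * s i l m) + (\<Sum>l<n. s k i l * s j l m) + (\<Sum>l<n. s i j l * s k l m) = 0"
proof -
  note d = assms(1)[unfolded structure_constants_def]
  show "s i i k = 0"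
    using d assms(2,4) by blast
  show "s i j k = - s j i k"
    by (rule d[THEN conjunct2, THEN conjunct1, rule_format, OF assms(2-4)])
  show "(\<Sum>l<n. s j k l * s i l m) + (\<Sum>l<n. s k i l * s j l m) + (\<Sum>l<n. s i j l * s k l m) = 0"
    if "m < n"
    by (rule d[THEN conjunct2, THEN conjunct2, rule_format, OF assms(2-4) that])
qed

text \<open>
  The scalars act through \<open>h\<close> and the coordinates are confined to the image of \<open>h\<close>, so that
  both \<open>\<complex>[z]\<^sup>n\<close> and its real form \<open>\<real>[z]\<^sup>n\<close> inside \<open>\<complex>[z]\<^sup>n\<close> are instances.
\<close>

definition coord_algebra ::
  "('s \<Rightarrow> 'r::comm_ring_1) \<Rightarrow> nat \<Rightarrow> (nat \<Rightarrow> nat \<Rightarrow> nat \<Rightarrow> 'r) \<Rightarrow> ('s, nat \<Rightarrow> 'r) module" where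
  "coord_algebra h n s =
     \<lparr>carrier = {v. (\<forall>i. v i \<in> range h) \<and> (\<forall>i\<ge>n. v i = 0)},
      monoid.mult = (\<lambda>u v k. if k < n then \<Sum>i<n. \<Sum>j<n. u i * v j * s i j k else 0),
      one = undefined,
      zero = (\<lambda>i. 0),
      add = (\<lambda>u v i. u i + v i),
      module.smult = (\<lambda>c v i. h c * v i)\<rparr>"

lemma coord_algebra_simps [simp]:
  "carrier (coord_algebra h n s) = {v. (\<forall>i. v i \<in> range h) \<and> (\<forall>i\<ge>n. v i = 0)}"
  "u \<otimes>\<^bsub>coord_algebra h n s\<^esub> v =
     (\<lambda>k. if k < n then \<Sum>i<n. \<Sum>j<n. u i * v j * s i j k else 0)"
  "\<zero>\<^bsub>coord_algebra h n s\<^esub> = (\<lambda>i. 0)"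
  "u \<oplus>\<^bsub>coord_algebra h n s\<^esub> v = (\<lambda>i. u i + v i)"
  "c \<odot>\<^bsub>coord_algebra h n s\<^esub> v = (\<lambda>i. h c * v i)"
  by (simp_all add: coord_algebra_def)

text \<open>Injectivity allows a coordinate in the image of \<open>h\<close> to be read back as a
  unique scalar; freeness and evaluation at a parameter both rest on this. Complex conjugation is a
  further instance, which makes coefficientwise conjugation compatible with sums and
  products.\<close>

locale scalar_embedding =
  fixes h :: "'s::comm_ring_1 \<Rightarrow> 'r::comm_ring_1"
  assumes add: "h (a + b) = h a + h b" and mult: "h (a * b) = h a * h b"
    and one: "h 1 = 1" and inj: "inj h"
begin

lemma zero: "h 0 = 0"
  using add[of 0 0] by simp

lemma uminus: "h (- a) = - h a"
  using add[of a "- a"] by (simp add: zero eq_neg_iff_add_eq_0 add.commute)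

lemma sum: "h (sum f A) = (\<Sum>x\<in>A. h (f x))"
  by (induction A rule: infinite_finite_induct) (simp_all add: zero add)

lemma range_add: "a \<in> range h \<Longrightarrow> b \<in> range h \<Longrightarrow> a + b \<in> range h"
  by (auto simp flip: add)

lemma range_mult: "a \<in> range h \<Longrightarrow> b \<in> range h \<Longrightarrow> a * b \<in> range h"
  by (auto simp flip: mult)

lemma range_uminus: "a \<in> range h \<Longrightarrow> - a \<in> range h"
  by (auto simp flip: uminus)

lemma range_zero: "0 \<in> range h"
  by (metis zero rangeI)

lemma range_sum: "(\<And>x. x \<in> A \<Longrightarrow> f x \<in> range h) \<Longrightarrow> sum f A \<in> range h"
  by (induction A rule: infinite_finite_induct) (simp_all add: range_zero range_add)

lemma structure_constants_map:
  assumes "structure_constants n s"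
  shows "structure_constants n (\<lambda>i j k. h (s i j k))"
proof -
  have "(\<Sum>l<n. h (s j k l) * h (s i l m)) + (\<Sum>l<n. h (s k i l) * h (s j l m)) +
      (\<Sum>l<n. h (s i j l) * h (s k l m)) = 0" if "i < n" "j < n" "k < n" "m < n" for i j k m
  proof -
    have "h ((\<Sum>l<n. s j k l * s i l m) + (\<Sum>l<n. s k i l * s j l m) +
        (\<Sum>l<n. s i j l * s k l m)) = h 0"
      using structure_constantsD(3)[OF assms] that by simp
    then show ?thesis
      by (simp add: add mult sum zero)
  qed
  moreover have "h (s i i k) = 0" "h (s i j k) = - h (s j i k)" if "i < n" "j < n" "k < n" for i j k
    using structure_constantsD(1,2)[OF assms that] by (simp_all add: zero flip: uminus)
  ultimately show ?thesis
    unfolding structure_constants_def by (intro conjI allI impI) assumption+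
qed

end

text \<open>Exchanging the indices would only show that twice the sum is 0, which is too weak over a
  general ring. The induction instead cancels the new row against the new column and uses that the
  new corner is 0.\<close>

lemma sum_antisymmetric:
  fixes a :: "nat \<Rightarrow> nat \<Rightarrow> 'r::comm_ring_1"
  assumes "\<And>i. i < n \<Longrightarrow> a i i = 0" "\<And>i j. i < n \<Longrightarrow> j < n \<Longrightarrow> a i j = - a j i"
  shows "(\<Sum>i<n. \<Sum>j<n. a i j) = 0"
  using assms
proof (induction n)
  case (Suc n)
  have "(\<Sum>i<n. a i n) = (\<Sum>i<n. - a n i)"
    using Suc.prems(2) by (intro sum.cong refl) (metis lessI less_SucI lessThan_iff)
  moreover have "(\<Sum>i<n. \<Sum>j<n. a i j) = 0"
    by (rule Suc.IH) (simp_all add: Suc.prems(1), metis Suc.prems(2) less_SucI)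
  ultimately show ?case
    using Suc.prems(1) by (simp add: sum.distrib sum_negf)
next
  case 0
  show ?case by simp
qed

lemma sum_rotate:
  "(\<Sum>j\<in>A. \<Sum>k\<in>B. \<Sum>i\<in>C. f i j k) = (\<Sum>i\<in>C. \<Sum>j\<in>A. \<Sum>k\<in>B. f i j k)"
proof -
  have "(\<Sum>j\<in>A. \<Sum>k\<in>B. \<Sum>i\<in>C. f i j k) = (\<Sum>j\<in>A. \<Sum>i\<in>C. \<Sum>k\<in>B. f i j k)"
    by (intro sum.cong refl sum.swap)
  also have "\<dots> = (\<Sum>i\<in>C. \<Sum>j\<in>A. \<Sum>k\<in>B. f i j k)"
    by (rule sum.swap)
  finally show ?thesis .
qed

text \<open>Collects the nested bracket by the monomials x_i y_j z_k, so that the three cyclic terms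
  of the Jacobi identity can be compared coefficient by coefficient.\<close>

lemma coord_algebra_nested_bracket:
  fixes s :: "nat \<Rightarrow> nat \<Rightarrow> nat \<Rightarrow> 'r::comm_ring_1"
  assumes "m < n"
  shows "(x \<otimes>\<^bsub>coord_algebra h n s\<^esub> (y \<otimes>\<^bsub>coord_algebra h n s\<^esub> z)) m =
    (\<Sum>i<n. \<Sum>j<n. \<Sum>k<n. x i * y j * z k * (\<Sum>l<n. s j k l * s i l m))"
proof -
  have "(x \<otimes>\<^bsub>coord_algebra h n s\<^esub> (y \<otimes>\<^bsub>coord_algebra h n s\<^esub> z)) m =
    (\<Sum>i<n. \<Sum>l<n. \<Sum>j<n. \<Sum>k<n. x i * y j * z k * (s j k l * s i l m))"
    using assms by (auto simp: sum_distrib_left sum_distrib_right mult_ac intro!: sum.cong)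
  also have "\<dots> = (\<Sum>i<n. \<Sum>j<n. \<Sum>k<n. \<Sum>l<n. x i * y j * z k * (s j k l * s i l m))"
    by (intro sum.cong refl sum_rotate[symmetric])
  finally show ?thesis
    by (simp add: sum_distrib_left)
qed

lemma (in scalar_embedding) module_coord_algebra: "Module.module scalars (coord_algebra h n s)"
proof (rule moduleI)
  show "abelian_group (coord_algebra h n s)"
  proof (rule abelian_groupI)
    fix x assume "x \<in> carrier (coord_algebra h n s)"
    then show "\<exists>y\<in>carrier (coord_algebra h n s).
        y \<oplus>\<^bsub>coord_algebra h n s\<^esub> x = \<zero>\<^bsub>coord_algebra h n s\<^esub>"
      by (intro bexI[of _ "\<lambda>i. - x i"]) (auto simp: intro!: range_uminus)
  qed (auto simp: add_ac range_zero intro!: range_add)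
qed (auto simp: add mult one algebra_simps intro!: range_mult)

lemma (in scalar_embedding) lie_algebra_coord_algebra:
  assumes s: "structure_constants n s" and "\<And>i j k. s i j k \<in> range h"
  shows "lie_algebra (coord_algebra h n s)"
proof (intro lie_algebra.intro lie_algebra_axioms.intro)
  show "Module.module scalars (coord_algebra h n s)"
    by (rule module_coord_algebra)
next
  fix x y assume "x \<in> carrier (coord_algebra h n s)" "y \<in> carrier (coord_algebra h n s)"
  then show "x \<otimes>\<^bsub>coord_algebra h n s\<^esub> y \<in> carrier (coord_algebra h n s)"
    using assms(2) by (auto simp: intro!: range_sum range_mult range_zero)
next
  fix x assume "x \<in> carrier (coord_algebra h n s)"
  have "(\<Sum>i<n. \<Sum>j<n. x i * x j * s i j k) = 0" if "k < n" for k
  proof (rule sum_antisymmetric)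
    show "x i * x i * s i i k = 0" if "i < n" for i
      using structure_constantsD(1)[OF s that that \<open>k < n\<close>] by simp
    show "x i * x j * s i j k = - (x j * x i * s j i k)" if "i < n" "j < n" for i j
    proof -
      have "s i j k = - s j i k"
        using structure_constantsD(2)[OF s] that \<open>k < n\<close> by blast
      then show ?thesis by simp
    qed
  qed
  then show "x \<otimes>\<^bsub>coord_algebra h n s\<^esub> x = \<zero>\<^bsub>coord_algebra h n s\<^esub>"
    by auto
next
  fix x y z
  let ?L = "coord_algebra h n s"
  have "((x \<otimes>\<^bsub>?L\<^esub> (y \<otimes>\<^bsub>?L\<^esub> z)) \<oplus>\<^bsub>?L\<^esub> (y \<otimes>\<^bsub>?L\<^esub> (z \<otimes>\<^bsub>?L\<^esub> x)) \<oplus>\<^bsub>?L\<^esub> (z \<otimes>\<^bsub>?L\<^esub> (x \<otimes>\<^bsub>?L\<^esub> y))) m = 0" for m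
  proof (cases "m < n")
    case True
    \<comment> \<open>The cyclic change of arguments becomes a cyclic change of indices in
      \<open>?T\<close>. The coefficient of each monomial is then exactly the Jacobi sum of the
      constants.\<close>
    let ?T = "\<lambda>i j k. \<Sum>l<n. s j k l * s i l m"
    have "(x \<otimes>\<^bsub>?L\<^esub> (y \<otimes>\<^bsub>?L\<^esub> z)) m = (\<Sum>i<n. \<Sum>j<n. \<Sum>k<n. x i * y j * z k * ?T i j k)"
      by (rule coord_algebra_nested_bracket[OF True])
    moreover have "(y \<otimes>\<^bsub>?L\<^esub> (z \<otimes>\<^bsub>?L\<^esub> x)) m = (\<Sum>i<n. \<Sum>j<n. \<Sum>k<n. x i * y j * z k * ?T j k i)"
      unfolding coord_algebra_nested_bracket[OF True]
      by (subst sum_rotate) (simp add: mult_ac)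
    moreover have "(z \<otimes>\<^bsub>?L\<^esub> (x \<otimes>\<^bsub>?L\<^esub> y)) m = (\<Sum>i<n. \<Sum>j<n. \<Sum>k<n. x i * y j * z k * ?T k i j)"
      unfolding coord_algebra_nested_bracket[OF True]
      by (subst sum_rotate[symmetric]) (simp add: mult_ac)
    ultimately have "((x \<otimes>\<^bsub>?L\<^esub> (y \<otimes>\<^bsub>?L\<^esub> z)) \<oplus>\<^bsub>?L\<^esub> (y \<otimes>\<^bsub>?L\<^esub> (z \<otimes>\<^bsub>?L\<^esub> x)) \<oplus>\<^bsub>?L\<^esub> (z \<otimes>\<^bsub>?L\<^esub> (x \<otimes>\<^bsub>?L\<^esub> y))) m =
        (\<Sum>i<n. \<Sum>j<n. \<Sum>k<n. x i * y j * z k * (?T i j k + ?T j k i + ?T k i j))"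
      by (simp only: coord_algebra_simps(4) distrib_left sum.distrib)
    also have "\<dots> = 0"
      using structure_constantsD(3)[OF s _ _ _ True] by (intro sum.neutral ballI) simp
    finally show ?thesis .
  qed simp
  then show "(x \<otimes>\<^bsub>?L\<^esub> (y \<otimes>\<^bsub>?L\<^esub> z)) \<oplus>\<^bsub>?L\<^esub> (y \<otimes>\<^bsub>?L\<^esub> (z \<otimes>\<^bsub>?L\<^esub> x)) \<oplus>\<^bsub>?L\<^esub> (z \<otimes>\<^bsub>?L\<^esub> (x \<otimes>\<^bsub>?L\<^esub> y)) = \<zero>\<^bsub>?L\<^esub>"
    by (simp only: coord_algebra_simps(3) fun_eq_iff) simp
qed (auto simp: fun_eq_iff algebra_simps sum.distrib sum_distrib_left)

section \<open>Freeness of the coordinate module\<close>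

lemma (in scalar_embedding) finsum_coord_algebra:
  assumes "f \<in> A \<rightarrow> carrier (coord_algebra h n s)"
  shows "finsum (coord_algebra h n s) f A = (\<lambda>k. \<Sum>a\<in>A. f a k)"
proof -
  interpret Module.module scalars "coord_algebra h n s"
    by (rule module_coord_algebra)
  show ?thesis
  proof (cases "finite A")
    case True
    then show ?thesis using assms
    proof (induction A)
      case (insert a A)
      have "finsum (coord_algebra h n s) f (insert a A) =
          f a \<oplus>\<^bsub>coord_algebra h n s\<^esub> finsum (coord_algebra h n s) f A"
        using insert.hyps insert.prems by (intro M.finsum_insert) auto
      also have "finsum (coord_algebra h n s) f A = (\<lambda>k. \<Sum>a\<in>A. f a k)"
        using insert.prems by (intro insert.IH) auto
      finally show ?case
        using insert.hyps by simp
    qed (simp add: M.finsum_empty)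
  qed (simp add: M.finsum_infinite)
qed

lemma (in scalar_embedding) finite_free_coord_algebra: "finite_free (coord_algebra h n s)"
proof -
  define e where "e i = (\<lambda>j. if i = j then 1 else 0 :: 'r)" for i :: nat
  have inj_e: "inj_on e A" for A
    by (auto simp: inj_on_def e_def fun_eq_iff split: if_splits)
  have e_carrier: "e i \<in> carrier (coord_algebra h n s)" if "i < n" for i
    using that rangeI[of h 0] rangeI[of h 1] by (auto simp: e_def one zero)
  have expand: "(\<Oplus>\<^bsub>coord_algebra h n s\<^esub>b\<in>e ` {..<n}. c b \<odot>\<^bsub>coord_algebra h n s\<^esub> b) =
      (\<lambda>k. if k < n then h (c (e k)) else 0)" for c
  proof -
    interpret Module.module scalars "coord_algebra h n s"
      by (rule module_coord_algebra)
    have "(\<lambda>b. c b \<odot>\<^bsub>coord_algebra h n s\<^esub> b) \<in> e ` {..<n} \<rightarrow> carrier (coord_algebra h n s)"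
    proof (rule Pi_I)
      fix b assume "b \<in> e ` {..<n}"
      then have "b \<in> carrier (coord_algebra h n s)"
        using e_carrier by blast
      then show "c b \<odot>\<^bsub>coord_algebra h n s\<^esub> b \<in> carrier (coord_algebra h n s)"
        by (rule smult_closed[rotated]) simp
    qed
    then have "(\<Oplus>\<^bsub>coord_algebra h n s\<^esub>b\<in>e ` {..<n}. c b \<odot>\<^bsub>coord_algebra h n s\<^esub> b) =
        (\<lambda>k. \<Sum>b\<in>e ` {..<n}. h (c b) * b k)"
      by (simp add: finsum_coord_algebra)
    also have "\<dots> = (\<lambda>k. \<Sum>i<n. h (c (e i)) * e i k)"
      by (simp add: sum.reindex[OF inj_e])
    also have "\<dots> = (\<lambda>k. if k < n then h (c (e k)) else 0)"
      by (simp add: e_def if_distrib[of "(*) _"] cong: if_cong)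
    finally show ?thesis .
  qed
  have "\<exists>!c. c \<in> e ` {..<n} \<rightarrow>\<^sub>E UNIV \<and>
      x = (\<Oplus>\<^bsub>coord_algebra h n s\<^esub>b\<in>e ` {..<n}. c b \<odot>\<^bsub>coord_algebra h n s\<^esub> b)"
    if x: "x \<in> carrier (coord_algebra h n s)" for x
  proof (rule ex_ex1I)
    \<comment> \<open>The coordinates of \<open>x\<close>, pulled back along \<open>h\<close> to
      scalars and indexed by basis vectors instead of numbers. \<open>restrict\<close> supplies the
      default value off the basis that an extensional function must have.\<close>
    let ?c = "restrict (\<lambda>b. inv_into UNIV h (x (inv_into UNIV e b))) (e ` {..<n})"
    have "h (?c (e k)) = x k" if "k < n" for k
      using x that inv_f_f[OF inj_e] by (auto simp: f_inv_into_f)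
    then show "\<exists>c. c \<in> e ` {..<n} \<rightarrow>\<^sub>E UNIV \<and>
        x = (\<Oplus>\<^bsub>coord_algebra h n s\<^esub>b\<in>e ` {..<n}. c b \<odot>\<^bsub>coord_algebra h n s\<^esub> b)"
      unfolding expand using x by (intro exI[of _ ?c]) auto
  next
    fix c d
    assume c: "c \<in> e ` {..<n} \<rightarrow>\<^sub>E UNIV \<and>
        x = (\<Oplus>\<^bsub>coord_algebra h n s\<^esub>b\<in>e ` {..<n}. c b \<odot>\<^bsub>coord_algebra h n s\<^esub> b)"
      and d: "d \<in> e ` {..<n} \<rightarrow>\<^sub>E UNIV \<and>
        x = (\<Oplus>\<^bsub>coord_algebra h n s\<^esub>b\<in>e ` {..<n}. d b \<odot>\<^bsub>coord_algebra h n s\<^esub> b)"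
    have "c (e k) = d (e k)" if "k < n" for k
    proof -
      have "h (c (e k)) = h (d (e k))"
        using c d that unfolding expand by (metis (mono_tags, lifting))
      then show ?thesis by (simp add: inj_eq[OF inj])
    qed
    then show "c = d"
      using c d by (intro PiE_ext[of c "e ` {..<n}" "\<lambda>_. UNIV" d]) blast+
  qed
  then show ?thesis
    unfolding finite_free_def using e_carrier by (intro exI[of _ "e ` {..<n}"]) auto
qed


section \<open>Deforming the bracket of a symmetric Lie algebra\<close>

context lie_algebra
begin

lemma smult_in_carrier [simp]: "x \<in> carrier L \<Longrightarrow> c \<odot> x \<in> carrier L"
  by simp

lemma smult_left_distrib: "x \<in> carrier L \<Longrightarrow> (a + b) \<odot> x = a \<odot> x \<oplus> b \<odot> x"
  using smult_l_distr[of a b x] by simp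

lemma smult_right_distrib: "x \<in> carrier L \<Longrightarrow> y \<in> carrier L \<Longrightarrow> c \<odot> (x \<oplus> y) = c \<odot> x \<oplus> c \<odot> y"
  using smult_r_distr[of c x y] by simp

lemma smult_smult: "x \<in> carrier L \<Longrightarrow> a \<odot> (b \<odot> x) = (a * b) \<odot> x"
  using smult_assoc1[of a b x] by simp

lemma smult_1 [simp]: "x \<in> carrier L \<Longrightarrow> 1 \<odot> x = x"
  using smult_one[of x] by simp

lemma smult_0 [simp]: "x \<in> carrier L \<Longrightarrow> 0 \<odot> x = \<zero>"
  using smult_l_null[of x] by simp

lemma smult_uminus_left: "x \<in> carrier L \<Longrightarrow> (- c) \<odot> x = \<ominus> (c \<odot> x)"
  using smult_l_minus[of c x] by simp

lemma smult_uminus_right: "x \<in> carrier L \<Longrightarrow> c \<odot> (\<ominus> x) = \<ominus> (c \<odot> x)"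
  using smult_r_minus[of c x] by simp

lemma smult_zero [simp]: "c \<odot> \<zero> = \<zero>"
  using smult_r_null[of c] by simp

lemma uminus_eq_smult: "x \<in> carrier L \<Longrightarrow> \<ominus> x = (- 1) \<odot> x"
  by (simp add: smult_uminus_left)

lemma bracket_uminus_left:
  "x \<in> carrier L \<Longrightarrow> y \<in> carrier L \<Longrightarrow> (\<ominus> x) \<otimes> y = \<ominus> (x \<otimes> y)"
  by (simp add: uminus_eq_smult bracket_smult_left bracket_closed)

lemma bracket_uminus_right:
  "x \<in> carrier L \<Longrightarrow> y \<in> carrier L \<Longrightarrow> x \<otimes> (\<ominus> y) = \<ominus> (x \<otimes> y)"
  by (simp add: uminus_eq_smult bracket_smult_right bracket_closed)

lemma bracket_antisym:
  assumes "x \<in> carrier L" "y \<in> carrier L"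
  shows "y \<otimes> x = \<ominus> (x \<otimes> y)"
proof -
  have "\<zero> = (x \<oplus> y) \<otimes> (x \<oplus> y)"
    using assms bracket_self[of "x \<oplus> y"] by simp
  also have "\<dots> = (y \<otimes> x) \<oplus> (x \<otimes> y)"
    using assms by (simp add: bracket_add_left bracket_add_right bracket_self[of x] bracket_self[of y]
        bracket_closed M.a_comm)
  finally show ?thesis
    using assms by (simp add: M.minus_equality bracket_closed)
qed

end

section \<open>The eigenspace decomposition as a grading by Z/2\<close>

locale symmetric_lie = lie_algebra g for g :: "(real, 'a) module" (structure) +
  fixes \<theta> :: "'a \<Rightarrow> 'a"
  assumes hom: "lie_hom g g \<theta>"
    and involutive: "x \<in> carrier g \<Longrightarrow> \<theta> (\<theta> x) = x"
begin

lemma \<theta>_closed [simp]: "x \<in> carrier g \<Longrightarrow> \<theta> x \<in> carrier g"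
  and \<theta>_add: "x \<in> carrier g \<Longrightarrow> y \<in> carrier g \<Longrightarrow> \<theta> (x \<oplus> y) = \<theta> x \<oplus> \<theta> y"
  and \<theta>_smult: "x \<in> carrier g \<Longrightarrow> \<theta> (c \<odot> x) = c \<odot> \<theta> x"
  and \<theta>_bracket: "x \<in> carrier g \<Longrightarrow> y \<in> carrier g \<Longrightarrow> \<theta> (x \<otimes> y) = \<theta> x \<otimes> \<theta> y"
  using hom by (auto simp: lie_hom_def)

lemma \<theta>_uminus: "x \<in> carrier g \<Longrightarrow> \<theta> (\<ominus> x) = \<ominus> \<theta> x"
  by (simp add: uminus_eq_smult \<theta>_smult)

definition evens :: "'a set" where "evens = {x \<in> carrier g. \<theta> x = x}"

abbreviation odds :: "'a set" where "odds \<equiv> anti_fixed g \<theta>"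

definition even_part :: "'a \<Rightarrow> 'a" where "even_part x = (1 / 2) \<odot> (x \<oplus> \<theta> x)"

definition odd_part :: "'a \<Rightarrow> 'a" where "odd_part x = (1 / 2) \<odot> (x \<ominus> \<theta> x)"

lemma evensD: "x \<in> evens \<Longrightarrow> x \<in> carrier g" "x \<in> evens \<Longrightarrow> \<theta> x = x"
  by (simp_all add: evens_def)

lemma oddsD: "x \<in> odds \<Longrightarrow> x \<in> carrier g" "x \<in> odds \<Longrightarrow> \<theta> x = \<ominus> x"
  by (simp_all add: anti_fixed_def)

lemma half_double: "x \<in> carrier g \<Longrightarrow> (1 / 2) \<odot> (x \<oplus> x) = x"
  using smult_left_distrib[of x "1/2" "1/2"] by (simp add: smult_right_distrib)

lemma even_part_in: "x \<in> carrier g \<Longrightarrow> even_part x \<in> evens"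
  by (simp add: evens_def even_part_def \<theta>_smult \<theta>_add involutive M.a_comm)

lemma odd_part_in: "x \<in> carrier g \<Longrightarrow> odd_part x \<in> odds"
  by (simp add: anti_fixed_def odd_part_def a_minus_def \<theta>_smult \<theta>_add \<theta>_uminus involutive
      M.a_comm M.minus_add flip: smult_uminus_right)

lemma even_part_closed [simp]: "x \<in> carrier g \<Longrightarrow> even_part x \<in> carrier g"
  and odd_part_closed [simp]: "x \<in> carrier g \<Longrightarrow> odd_part x \<in> carrier g"
  using even_part_in odd_part_in evensD oddsD by blast+

lemma even_odd_decomp:
  assumes x: "x \<in> carrier g"
  shows "even_part x \<oplus> odd_part x = x"
proof -
  have "(x \<oplus> \<theta> x) \<oplus> (x \<ominus> \<theta> x) = (x \<oplus> x) \<oplus> (\<theta> x \<oplus> \<ominus> \<theta> x)"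
    using x by (simp add: a_minus_def M.a_ac)
  then have "(x \<oplus> \<theta> x) \<oplus> (x \<ominus> \<theta> x) = x \<oplus> x"
    using x by (simp add: M.r_neg)
  then show ?thesis
    using x by (simp add: even_part_def odd_part_def half_double flip: smult_right_distrib)
qed

text \<open>\<open>\<theta>\<close> sends a + b to a - b, so half the sum and half the difference of
  the two recover a and b. Parts of compound expressions are computed below by exhibiting them as
  even plus odd.\<close>

lemma parts_unique:
  assumes a: "a \<in> evens" and b: "b \<in> odds"
  shows "even_part (a \<oplus> b) = a" "odd_part (a \<oplus> b) = b"
proof -
  note c = evensD(1)[OF a] oddsD(1)[OF b]
  have \<theta>: "\<theta> (a \<oplus> b) = a \<oplus> \<ominus> b"
    using a b c by (simp add: \<theta>_add evensD oddsD)
  have "(a \<oplus> b) \<oplus> (a \<oplus> \<ominus> b) = (a \<oplus> a) \<oplus> (b \<oplus> \<ominus> b)"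
    using c by (simp add: M.a_ac)
  then show "even_part (a \<oplus> b) = a"
    using c by (simp add: even_part_def \<theta> M.r_neg half_double)
  have "(a \<oplus> b) \<ominus> (a \<oplus> \<ominus> b) = (b \<oplus> b) \<oplus> (a \<oplus> \<ominus> a)"
    using c by (simp add: a_minus_def M.minus_add M.a_ac)
  then show "odd_part (a \<oplus> b) = b"
    using c by (simp add: odd_part_def \<theta> M.r_neg half_double)
qed

lemma parts_unique':
  "z = a \<oplus> b \<Longrightarrow> a \<in> evens \<Longrightarrow> b \<in> odds \<Longrightarrow> even_part z = a \<and> odd_part z = b"
  using parts_unique by blast

lemma evens_add: "a \<in> evens \<Longrightarrow> b \<in> evens \<Longrightarrow> a \<oplus> b \<in> evens"
  and odds_add: "a \<in> odds \<Longrightarrow> b \<in> odds \<Longrightarrow> a \<oplus> b \<in> odds"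
  and evens_smult: "a \<in> evens \<Longrightarrow> c \<odot> a \<in> evens"
  and odds_smult: "a \<in> odds \<Longrightarrow> c \<odot> a \<in> odds"
  by (simp_all add: evens_def anti_fixed_def \<theta>_add \<theta>_smult M.minus_add smult_uminus_right)

lemma evens_bracket: "a \<in> evens \<Longrightarrow> b \<in> evens \<Longrightarrow> a \<otimes> b \<in> evens"
  and odds_bracket: "a \<in> odds \<Longrightarrow> b \<in> odds \<Longrightarrow> a \<otimes> b \<in> evens"
  and even_odd_bracket: "a \<in> evens \<Longrightarrow> b \<in> odds \<Longrightarrow> a \<otimes> b \<in> odds"
  and odd_even_bracket: "b \<in> odds \<Longrightarrow> a \<in> evens \<Longrightarrow> b \<otimes> a \<in> odds"
  by (simp_all add: evens_def anti_fixed_def \<theta>_bracket bracket_closed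
      bracket_uminus_left bracket_uminus_right)

lemma even_part_add: "x \<in> carrier g \<Longrightarrow> y \<in> carrier g \<Longrightarrow> even_part (x \<oplus> y) = even_part x \<oplus> even_part y"
  and odd_part_add: "x \<in> carrier g \<Longrightarrow> y \<in> carrier g \<Longrightarrow> odd_part (x \<oplus> y) = odd_part x \<oplus> odd_part y"
proof -
  assume c: "x \<in> carrier g" "y \<in> carrier g"
  have "x \<oplus> y = (even_part x \<oplus> odd_part x) \<oplus> (even_part y \<oplus> odd_part y)"
    using c by (simp add: even_odd_decomp)
  also have "\<dots> = (even_part x \<oplus> even_part y) \<oplus> (odd_part x \<oplus> odd_part y)"
    using c by (simp add: M.a_ac)
  finally have "even_part (x \<oplus> y) = even_part x \<oplus> even_part y \<and>
      odd_part (x \<oplus> y) = odd_part x \<oplus> odd_part y"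
    using c by (intro parts_unique' evens_add odds_add even_part_in odd_part_in)
  then show "even_part (x \<oplus> y) = even_part x \<oplus> even_part y"
    "odd_part (x \<oplus> y) = odd_part x \<oplus> odd_part y" by simp_all
qed

lemma even_part_smult: "x \<in> carrier g \<Longrightarrow> even_part (c \<odot> x) = c \<odot> even_part x"
  and odd_part_smult: "x \<in> carrier g \<Longrightarrow> odd_part (c \<odot> x) = c \<odot> odd_part x"
proof -
  assume c: "x \<in> carrier g"
  have "c \<odot> x = c \<odot> (even_part x \<oplus> odd_part x)"
    using c by (simp add: even_odd_decomp)
  also have "\<dots> = c \<odot> even_part x \<oplus> c \<odot> odd_part x"
    using c by (simp add: smult_right_distrib)
  finally have "even_part (c \<odot> x) = c \<odot> even_part x \<and> odd_part (c \<odot> x) = c \<odot> odd_part x"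
    using c by (intro parts_unique' evens_smult odds_smult even_part_in odd_part_in)
  then show "even_part (c \<odot> x) = c \<odot> even_part x" "odd_part (c \<odot> x) = c \<odot> odd_part x"
    by simp_all
qed

section \<open>The bracket at a fixed real parameter; the value 1 gives back
  \<open>g\<close>\<close>

definition deform :: "real \<Rightarrow> (real, 'a) module" where
  "deform \<alpha> = g\<lparr>monoid.mult := \<lambda>x y. (x \<otimes> y) \<oplus> (\<alpha> - 1) \<odot> (odd_part x \<otimes> odd_part y)\<rparr>"

lemma deform_simps [simp]:
  "carrier (deform \<alpha>) = carrier g" "\<zero>\<^bsub>deform \<alpha>\<^esub> = \<zero>" "add (deform \<alpha>) = add g"
  "module.smult (deform \<alpha>) = module.smult g"
  by (simp_all add: deform_def)

lemma deform_bracket: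
  "x \<otimes>\<^bsub>deform \<alpha>\<^esub> y = (x \<otimes> y) \<oplus> (\<alpha> - 1) \<odot> (odd_part x \<otimes> odd_part y)"
  by (simp add: deform_def)

text \<open>The bracket of the odd parts occurs once in [x, y] and \<alpha> - 1 times in the
  correction, hence \<alpha> times in all. By the grading it lies in the even part, while the mixed
  brackets form the odd part.\<close>

lemma deform_parts:
  assumes "x \<in> carrier g" "y \<in> carrier g"
  shows "even_part (x \<otimes>\<^bsub>deform \<alpha>\<^esub> y) =
      (even_part x \<otimes> even_part y) \<oplus> \<alpha> \<odot> (odd_part x \<otimes> odd_part y)"
    and "odd_part (x \<otimes>\<^bsub>deform \<alpha>\<^esub> y) =
      (even_part x \<otimes> odd_part y) \<oplus> (odd_part x \<otimes> even_part y)"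
proof -
  let ?e = "even_part" and ?o = "odd_part"
  note c = assms even_part_closed[OF assms(1)] even_part_closed[OF assms(2)]
    odd_part_closed[OF assms(1)] odd_part_closed[OF assms(2)]
  note p = even_part_in[OF assms(1)] even_part_in[OF assms(2)]
    odd_part_in[OF assms(1)] odd_part_in[OF assms(2)]
  have "x \<otimes> y = (?e x \<oplus> ?o x) \<otimes> (?e y \<oplus> ?o y)"
    using c by (simp add: even_odd_decomp)
  then have "x \<otimes>\<^bsub>deform \<alpha>\<^esub> y = ((?e x \<otimes> ?e y) \<oplus> ((?o x \<otimes> ?o y) \<oplus> (\<alpha> - 1) \<odot> (?o x \<otimes> ?o y))) \<oplus>
      ((?e x \<otimes> ?o y) \<oplus> (?o x \<otimes> ?e y))"
    using c by (simp add: deform_bracket bracket_add_left bracket_add_right bracket_closed M.a_ac)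
  moreover have "(?o x \<otimes> ?o y) \<oplus> (\<alpha> - 1) \<odot> (?o x \<otimes> ?o y) = \<alpha> \<odot> (?o x \<otimes> ?o y)"
    using c smult_left_distrib[of "?o x \<otimes> ?o y" 1 "\<alpha> - 1"] by (simp add: bracket_closed)
  ultimately have "x \<otimes>\<^bsub>deform \<alpha>\<^esub> y = ((?e x \<otimes> ?e y) \<oplus> \<alpha> \<odot> (?o x \<otimes> ?o y)) \<oplus>
      ((?e x \<otimes> ?o y) \<oplus> (?o x \<otimes> ?e y))"
    by simp
  then have "?e (x \<otimes>\<^bsub>deform \<alpha>\<^esub> y) = (?e x \<otimes> ?e y) \<oplus> \<alpha> \<odot> (?o x \<otimes> ?o y) \<and>
      ?o (x \<otimes>\<^bsub>deform \<alpha>\<^esub> y) = (?e x \<otimes> ?o y) \<oplus> (?o x \<otimes> ?e y)"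
    using p by (intro parts_unique' evens_add odds_add evens_smult
        evens_bracket odds_bracket even_odd_bracket odd_even_bracket)
  then show "?e (x \<otimes>\<^bsub>deform \<alpha>\<^esub> y) = (?e x \<otimes> ?e y) \<oplus> \<alpha> \<odot> (?o x \<otimes> ?o y)"
    "?o (x \<otimes>\<^bsub>deform \<alpha>\<^esub> y) = (?e x \<otimes> ?o y) \<oplus> (?o x \<otimes> ?e y)"
    by simp_all
qed

lemma deform_closed: "x \<in> carrier g \<Longrightarrow> y \<in> carrier g \<Longrightarrow> x \<otimes>\<^bsub>deform \<alpha>\<^esub> y \<in> carrier g"
  by (simp add: deform_bracket bracket_closed)

text \<open>The bijection behind all three cases: c is a square root of the absolute value of
  \<alpha> when \<alpha> is nonzero, and 1 when it is zero.\<close>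

lemma scaled_parts_bij:
  assumes "c \<noteq> 0"
  shows "bij_betw (\<lambda>x. (even_part x, c \<odot> odd_part x)) (carrier g) (evens \<times> odds)"
proof (rule bij_betwI)
  show "(\<lambda>x. (even_part x, c \<odot> odd_part x)) \<in> carrier g \<rightarrow> evens \<times> odds"
    by (auto simp: even_part_in odd_part_in odds_smult)
  show "(\<lambda>(a, b). a \<oplus> (1 / c) \<odot> b) \<in> evens \<times> odds \<rightarrow> carrier g"
    by (auto simp: evensD oddsD)
  show "(case (even_part x, c \<odot> odd_part x) of (a, b) \<Rightarrow> a \<oplus> (1 / c) \<odot> b) = x"
    if "x \<in> carrier g" for x
    using that assms by (simp add: smult_smult even_odd_decomp)
  show "(even_part (case y of (a, b) \<Rightarrow> a \<oplus> (1 / c) \<odot> b),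
      c \<odot> odd_part (case y of (a, b) \<Rightarrow> a \<oplus> (1 / c) \<odot> b)) = y" if y_in: "y \<in> evens \<times> odds" for y
  proof -
    obtain a b where y: "y = (a, b)" "a \<in> evens" "b \<in> odds"
      using y_in by auto
    then have "even_part (a \<oplus> (1 / c) \<odot> b) = a" "odd_part (a \<oplus> (1 / c) \<odot> b) = (1 / c) \<odot> b"
      by (simp_all add: parts_unique odds_smult)
    then show ?thesis
      using y assms by (simp add: smult_smult oddsD)
  qed
qed

text \<open>In \<open>g\<close> the bracket of c y and c y' is c^2 [y, y'] = \<alpha> [y, y'], the
  deformed bracket of odd elements. Mixed brackets pick up one factor c, as odd elements
  should.\<close>

lemma deform_pos_iso:
  assumes "c \<noteq> 0" "c * c = \<alpha>"
  shows "lie_iso (deform \<alpha>) g (\<lambda>x. even_part x \<oplus> c \<odot> odd_part x)"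
  unfolding lie_iso_def lie_hom_def
proof (intro conjI ballI allI)
  have "bij_betw (\<lambda>(a, b). a \<oplus> b) (evens \<times> odds) (carrier g)"
  proof (rule bij_betwI[where g = "\<lambda>x. (even_part x, odd_part x)"])
    show "(\<lambda>(a, b). a \<oplus> b) \<in> evens \<times> odds \<rightarrow> carrier g"
      by (auto simp: evensD oddsD)
  qed (auto simp: even_part_in odd_part_in even_odd_decomp parts_unique)
  with scaled_parts_bij[OF assms(1)]
  have "bij_betw ((\<lambda>(a, b). a \<oplus> b) \<circ> (\<lambda>x. (even_part x, c \<odot> odd_part x))) (carrier g) (carrier g)"
    by (rule bij_betw_trans)
  then show "bij_betw (\<lambda>x. even_part x \<oplus> c \<odot> odd_part x) (carrier (deform \<alpha>)) (carrier g)"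
    by (simp add: comp_def)
next
  fix x y assume "x \<in> carrier (deform \<alpha>)" "y \<in> carrier (deform \<alpha>)"
  then show "even_part (x \<otimes>\<^bsub>deform \<alpha>\<^esub> y) \<oplus> c \<odot> odd_part (x \<otimes>\<^bsub>deform \<alpha>\<^esub> y) =
      (even_part x \<oplus> c \<odot> odd_part x) \<otimes> (even_part y \<oplus> c \<odot> odd_part y)"
    by (simp add: deform_parts bracket_add_left bracket_add_right bracket_smult_left
        bracket_smult_right bracket_closed smult_right_distrib smult_smult assms(2) M.a_ac)
qed (auto simp: even_part_add odd_part_add even_part_smult odd_part_smult smult_right_distrib
      smult_smult mult.commute M.a_ac)

text \<open>The pair stands for x + i c y with x even and y odd. Here (i c)^2 = - c^2 = \<alpha>, so
  the sign comes from i and the size from c.\<close>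

lemma deform_neg_iso:
  assumes "c \<noteq> 0" "c * c = - \<alpha>"
  shows "lie_iso (deform \<alpha>) (dual_real_form g \<theta>) (\<lambda>x. (even_part x, c \<odot> odd_part x))"
  unfolding lie_iso_def lie_hom_def
proof (intro conjI ballI allI)
  \<comment> \<open>Conjugation after the extension of \<open>\<theta>\<close> maps (x, y) to
    (\<theta> x, - \<theta> y), so being fixed means that x is even and y is odd.\<close>
  have "\<theta> y = \<ominus> y \<longleftrightarrow> \<ominus> \<theta> y = y" if "y \<in> carrier g" for y
    using that by (metis M.minus_minus \<theta>_closed)
  then have carrier: "carrier (dual_real_form g \<theta>) = evens \<times> odds"
    by (auto simp: dual_real_form_def fixed_subalgebra_def restrict_scalars_def
        complexification_def conjugation_def complex_linear_extension_def evens_def anti_fixed_def)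
  show "bij_betw (\<lambda>x. (even_part x, c \<odot> odd_part x)) (carrier (deform \<alpha>)) (carrier (dual_real_form g \<theta>))"
    unfolding carrier deform_simps by (rule scaled_parts_bij[OF assms(1)])
  then show "(\<lambda>x. (even_part x, c \<odot> odd_part x)) \<in> carrier (deform \<alpha>) \<rightarrow> carrier (dual_real_form g \<theta>)"
    by (rule bij_betw_imp_funcset)
next
  fix x y assume "x \<in> carrier (deform \<alpha>)" "y \<in> carrier (deform \<alpha>)"
  then show "(even_part (x \<otimes>\<^bsub>deform \<alpha>\<^esub> y), c \<odot> odd_part (x \<otimes>\<^bsub>deform \<alpha>\<^esub> y)) =
      (even_part x, c \<odot> odd_part x) \<otimes>\<^bsub>dual_real_form g \<theta>\<^esub> (even_part y, c \<odot> odd_part y)"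
    by (simp add: dual_real_form_def fixed_subalgebra_def restrict_scalars_def
        complexification_def deform_parts bracket_smult_left a_minus_def
        bracket_smult_right bracket_closed smult_right_distrib smult_smult assms(2)
        flip: smult_uminus_left)
qed (auto simp: dual_real_form_def fixed_subalgebra_def restrict_scalars_def complexification_def
      even_part_add odd_part_add even_part_smult odd_part_smult smult_right_distrib
      smult_smult mult.commute a_minus_def)

lemma deform_zero_iso:
  "lie_iso (deform 0) (symmetric_semidirect g \<theta>) (\<lambda>x. (even_part x, odd_part x))"
  unfolding lie_iso_def lie_hom_def
proof (intro conjI ballI allI)
  have carrier: "carrier (symmetric_semidirect g \<theta>) = evens \<times> odds"
    by (simp add: symmetric_semidirect_def fixed_subalgebra_def evens_def)
  have "bij_betw (\<lambda>x. (even_part x, 1 \<odot> odd_part x)) (carrier g) (evens \<times> odds)"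
    by (rule scaled_parts_bij) simp
  then show "bij_betw (\<lambda>x. (even_part x, odd_part x)) (carrier (deform 0)) (carrier (symmetric_semidirect g \<theta>))"
    unfolding carrier deform_simps by (rule bij_betw_cong[THEN iffD1, rotated]) simp
  then show "(\<lambda>x. (even_part x, odd_part x)) \<in> carrier (deform 0) \<rightarrow> carrier (symmetric_semidirect g \<theta>)"
    by (rule bij_betw_imp_funcset)
next
  fix x y assume "x \<in> carrier (deform 0)" "y \<in> carrier (deform 0)"
  then show "(even_part (x \<otimes>\<^bsub>deform 0\<^esub> y), odd_part (x \<otimes>\<^bsub>deform 0\<^esub> y)) =
      (even_part x, odd_part x) \<otimes>\<^bsub>symmetric_semidirect g \<theta>\<^esub> (even_part y, odd_part y)"
    \<comment> \<open>The semidirect bracket always has the even factor on the left, so the odd-even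
      term has to be turned around.\<close>
    using bracket_antisym[of "even_part y" "odd_part x"]
    by (simp add: symmetric_semidirect_def deform_parts bracket_closed a_minus_def)
qed (auto simp: symmetric_semidirect_def even_part_add odd_part_add even_part_smult odd_part_smult)

lemma deform_bilinear:
  assumes "x \<in> carrier g" "y \<in> carrier g" "z \<in> carrier g"
  shows "(x \<oplus> y) \<otimes>\<^bsub>deform \<alpha>\<^esub> z = (x \<otimes>\<^bsub>deform \<alpha>\<^esub> z) \<oplus> (y \<otimes>\<^bsub>deform \<alpha>\<^esub> z)"
    "z \<otimes>\<^bsub>deform \<alpha>\<^esub> (x \<oplus> y) = (z \<otimes>\<^bsub>deform \<alpha>\<^esub> x) \<oplus> (z \<otimes>\<^bsub>deform \<alpha>\<^esub> y)"
    "(c \<odot> x) \<otimes>\<^bsub>deform \<alpha>\<^esub> y = c \<odot> (x \<otimes>\<^bsub>deform \<alpha>\<^esub> y)"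
    "x \<otimes>\<^bsub>deform \<alpha>\<^esub> (c \<odot> y) = c \<odot> (x \<otimes>\<^bsub>deform \<alpha>\<^esub> y)"
  using assms
  by (simp_all add: deform_bracket odd_part_add odd_part_smult bracket_closed bracket_add_left
      bracket_add_right bracket_smult_left bracket_smult_right smult_right_distrib
      smult_smult mult.commute M.a_ac)

lemma deform_self: "x \<in> carrier g \<Longrightarrow> x \<otimes>\<^bsub>deform \<alpha>\<^esub> x = \<zero>"
  by (simp add: deform_bracket bracket_self)

lemma deform_antisym:
  assumes "x \<in> carrier g" "y \<in> carrier g"
  shows "x \<otimes>\<^bsub>deform \<alpha>\<^esub> y = \<ominus> (y \<otimes>\<^bsub>deform \<alpha>\<^esub> x)"
  using assms bracket_antisym[of y x] bracket_antisym[of "odd_part y" "odd_part x"]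
  by (simp add: deform_bracket bracket_closed M.minus_add smult_uminus_right)

text \<open>The injective map \<open>\<phi>\<close> carries the Jacobi sum of the deformed bracket
  to a Jacobi sum in \<open>g\<close>, which is zero.\<close>

lemma deform_pos_jacobi:
  assumes "\<alpha> > 0" and xyz: "x \<in> carrier g" "y \<in> carrier g" "z \<in> carrier g"
  shows "(x \<otimes>\<^bsub>deform \<alpha>\<^esub> (y \<otimes>\<^bsub>deform \<alpha>\<^esub> z)) \<oplus> (y \<otimes>\<^bsub>deform \<alpha>\<^esub> (z \<otimes>\<^bsub>deform \<alpha>\<^esub> x)) \<oplus>
    (z \<otimes>\<^bsub>deform \<alpha>\<^esub> (x \<otimes>\<^bsub>deform \<alpha>\<^esub> y)) = \<zero>" (is "?J = _")
proof -
  define \<phi> where "\<phi> x = even_part x \<oplus> sqrt \<alpha> \<odot> odd_part x" for x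
  have iso: "lie_iso (deform \<alpha>) g \<phi>"
    unfolding \<phi>_def[abs_def] using assms by (intro deform_pos_iso) simp_all
  have closed: "\<phi> x \<in> carrier g" if "x \<in> carrier g" for x
    using that by (simp add: \<phi>_def)
  have add: "\<phi> (x \<oplus> y) = \<phi> x \<oplus> \<phi> y" and bracket: "\<phi> (x \<otimes>\<^bsub>deform \<alpha>\<^esub> y) = \<phi> x \<otimes> \<phi> y"
    if "x \<in> carrier g" "y \<in> carrier g" for x y
    using iso that by (auto simp: lie_iso_def lie_hom_def)
  have "\<phi> ?J = \<zero>"
    using xyz by (simp add: add bracket closed deform_closed jacobi)
  moreover have "\<phi> \<zero> = \<zero>"
    using add[of \<zero> \<zero>] closed[of \<zero>] by simp
  moreover have "inj_on \<phi> (carrier g)"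
    using iso by (simp add: lie_iso_def bij_betw_def)
  ultimately show ?thesis
    using xyz by (simp add: inj_on_def deform_closed)
qed

end


section \<open>Coordinates\<close>

text \<open>A numbered basis with its coordinate functions. The values of \<open>coord\<close> at
  indices from \<open>n\<close> on are left open, hence the guards \<open>i < n\<close>
  throughout.\<close>

locale lie_algebra_basis = lie_algebra L for L :: "('r::comm_ring_1, 'a) module" (structure) +
  fixes n :: nat and e :: "nat \<Rightarrow> 'a" and coord :: "'a \<Rightarrow> nat \<Rightarrow> 'r"
  assumes e_closed: "i < n \<Longrightarrow> e i \<in> carrier L"
    and coord_finsum: "i < n \<Longrightarrow> coord (\<Oplus>\<^bsub>L\<^esub>i\<in>{..<n}. v i \<odot> e i) i = v i"
    and finsum_coord: "x \<in> carrier L \<Longrightarrow> (\<Oplus>\<^bsub>L\<^esub>i\<in>{..<n}. coord x i \<odot> e i) = x"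

lemma (in lie_algebra) finite_free_basis:
  assumes "finite_free L"
  obtains n e coord where "lie_algebra_basis L n e coord"
proof -
  obtain B where B: "finite B" "B \<subseteq> carrier L"
    and ex1: "\<And>x. x \<in> carrier L \<Longrightarrow> \<exists>!c. c \<in> B \<rightarrow>\<^sub>E UNIV \<and> x = (\<Oplus>b\<in>B. c b \<odot> b)"
    using assms unfolding finite_free_def
    by (elim exE conjE) (rule that, assumption, assumption, erule bspec, assumption)
  obtain e where e: "bij_betw e {..<card B} B"
    using ex_bij_betw_nat_finite[OF B(1)] by (auto simp: lessThan_atLeast0)
  define n where "n = card B"
  define C where "C x = (THE c. c \<in> B \<rightarrow>\<^sub>E UNIV \<and> x = (\<Oplus>b\<in>B. c b \<odot> b))" for x
  have C: "C x \<in> B \<rightarrow>\<^sub>E UNIV \<and> x = (\<Oplus>b\<in>B. C x b \<odot> b)" if "x \<in> carrier L" for x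
    unfolding C_def by (rule theI'[OF ex1[OF that]])
  have inj: "inj_on e {..<n}" and img: "e ` {..<n} = B"
    using e by (auto simp: bij_betw_def n_def)
  have closed: "e i \<in> carrier L" if "i < n" for i
    using that img B(2) by auto
  have reindex: "(\<Oplus>b\<in>B. c b \<odot> b) = (\<Oplus>i\<in>{..<n}. c (e i) \<odot> e i)" for c
    unfolding img[symmetric] by (rule M.finsum_reindex) (use closed inj in auto)
  have "lie_algebra_basis L n e (\<lambda>x i. C x (e i))"
  proof unfold_locales
    fix x assume "x \<in> carrier L"
    then show "(\<Oplus>i\<in>{..<n}. C x (e i) \<odot> e i) = x"
      using C[of x] reindex[of "C x"] by simp
  next
    fix i v assume i: "i < n"
    \<comment> \<open>\<open>?c\<close> is \<open>v\<close> transported from indices to basis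
      vectors and made extensional, so that uniqueness of coefficients identifies it with
      \<open>C ?x\<close>.\<close>
    let ?x = "\<Oplus>i\<in>{..<n}. v i \<odot> e i" and ?c = "restrict (\<lambda>b. v (inv_into {..<n} e b)) B"
    have c: "?c (e j) = v j" if "j < n" for j
      using that img inj by (auto simp: inv_into_f_f)
    have x: "?x \<in> carrier L"
      using closed by (intro M.finsum_closed) auto
    have "?x = (\<Oplus>i\<in>{..<n}. ?c (e i) \<odot> e i)"
      using closed c by (intro M.finsum_cong') auto
    then have "?c \<in> B \<rightarrow>\<^sub>E UNIV \<and> ?x = (\<Oplus>b\<in>B. ?c b \<odot> b)"
      unfolding reindex by simp
    then have "C ?x = ?c"
      using ex1[OF x] C[OF x] by blast
    then show "C ?x (e i) = v i"
      using c[OF i] by simp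
  qed (rule closed)
  then show ?thesis ..
qed

context lie_algebra_basis
begin

definition comb :: "(nat \<Rightarrow> 'r) \<Rightarrow> 'a" where "comb v = (\<Oplus>i\<in>{..<n}. v i \<odot> e i)"

lemma coord_comb: "i < n \<Longrightarrow> coord (comb v) i = v i"
  and comb_coord: "x \<in> carrier L \<Longrightarrow> comb (coord x) = x"
  by (simp_all add: comb_def coord_finsum finsum_coord)

lemma comb_closed [simp]: "comb v \<in> carrier L"
  unfolding comb_def using e_closed by (intro M.finsum_closed) auto

lemma comb_cong: "(\<And>i. i < n \<Longrightarrow> u i = v i) \<Longrightarrow> comb u = comb v"
  unfolding comb_def using e_closed by (intro M.finsum_cong') auto

lemma comb_eq_iff: "comb u = comb v \<longleftrightarrow> (\<forall>i<n. u i = v i)"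
  using comb_cong coord_comb by metis

lemma comb_add: "comb (\<lambda>i. u i + v i) = comb u \<oplus> comb v"
proof -
  have "comb (\<lambda>i. u i + v i) = (\<Oplus>i\<in>{..<n}. u i \<odot> e i \<oplus> v i \<odot> e i)"
    unfolding comb_def using e_closed by (intro M.finsum_cong') (auto simp: smult_left_distrib)
  also have "\<dots> = comb u \<oplus> comb v"
    unfolding comb_def using e_closed by (intro M.finsum_addf) auto
  finally show ?thesis .
qed

lemma comb_smult: "comb (\<lambda>i. c * v i) = c \<odot> comb v"
proof -
  have "c \<odot> comb v = (\<Oplus>i\<in>{..<n}. c \<odot> (v i \<odot> e i))"
    unfolding comb_def using e_closed by (intro finsum_smult_ldistr) auto
  also have "\<dots> = comb (\<lambda>i. c * v i)"
    unfolding comb_def using e_closed by (intro M.finsum_cong') (auto simp: smult_smult)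
  finally show ?thesis by simp
qed

lemma coord_add:
  assumes "x \<in> carrier L" "y \<in> carrier L" "i < n"
  shows "coord (x \<oplus> y) i = coord x i + coord y i"
  using assms coord_comb[OF assms(3), of "\<lambda>i. coord x i + coord y i"]
  by (simp add: comb_add comb_coord)

lemma coord_smult:
  assumes "x \<in> carrier L" "i < n"
  shows "coord (c \<odot> x) i = c * coord x i"
  using assms coord_comb[OF assms(2), of "\<lambda>i. c * coord x i"]
  by (simp add: comb_smult comb_coord)

lemma coord_zero: "i < n \<Longrightarrow> coord \<zero> i = 0"
  using coord_smult[of \<zero> i 0] by simp

lemma coord_uminus: "x \<in> carrier L \<Longrightarrow> i < n \<Longrightarrow> coord (\<ominus> x) i = - coord x i"
  by (simp add: uminus_eq_smult coord_smult)

lemma functional_comb: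
  fixes f :: "'a \<Rightarrow> 'r"
  assumes add: "\<And>x y. x \<in> carrier L \<Longrightarrow> y \<in> carrier L \<Longrightarrow> f (x \<oplus> y) = f x + f y"
    and smult: "\<And>c x. x \<in> carrier L \<Longrightarrow> f (c \<odot> x) = c * f x"
  shows "f (comb v) = (\<Sum>i<n. v i * f (e i))"
proof -
  have "f (\<Oplus>i\<in>{..<m}. v i \<odot> e i) = (\<Sum>i<m. v i * f (e i))" if "m \<le> n" for m
    using that
  proof (induction m)
    case 0
    then show ?case using smult[of \<zero> 0] by simp
  next
    case (Suc m)
    then have "(\<Oplus>i\<in>{..<Suc m}. v i \<odot> e i) = v m \<odot> e m \<oplus> (\<Oplus>i\<in>{..<m}. v i \<odot> e i)"
      using e_closed by (auto simp: lessThan_Suc intro!: M.finsum_insert)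
    moreover have "(\<Oplus>i\<in>{..<m}. v i \<odot> e i) \<in> carrier L"
      using Suc.prems e_closed by (intro M.finsum_closed) auto
    ultimately show ?case
      using Suc e_closed[of m] by (simp add: add smult add.commute)
  qed
  then show ?thesis
    unfolding comb_def by simp
qed

text \<open>Stated for an arbitrary bilinear map \<open>b\<close> because it is applied to the
  deformed brackets, for every parameter, with the coordinates of the undeformed algebra.\<close>

lemma coord_bilinear:
  assumes closed: "\<And>x y. x \<in> carrier L \<Longrightarrow> y \<in> carrier L \<Longrightarrow> b x y \<in> carrier L"
    and add: "\<And>x y z. x \<in> carrier L \<Longrightarrow> y \<in> carrier L \<Longrightarrow> z \<in> carrier L \<Longrightarrow> b (x \<oplus> y) z = b x z \<oplus> b y z"
      "\<And>x y z. x \<in> carrier L \<Longrightarrow> y \<in> carrier L \<Longrightarrow> z \<in> carrier L \<Longrightarrow> b z (x \<oplus> y) = b z x \<oplus> b z y"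
    and smult: "\<And>c x y. x \<in> carrier L \<Longrightarrow> y \<in> carrier L \<Longrightarrow> b (c \<odot> x) y = c \<odot> b x y"
      "\<And>c x y. x \<in> carrier L \<Longrightarrow> y \<in> carrier L \<Longrightarrow> b x (c \<odot> y) = c \<odot> b x y"
    and k: "k < n"
  shows "y \<in> carrier L \<Longrightarrow> coord (b (comb u) y) k = (\<Sum>i<n. u i * coord (b (e i) y) k)"
    "x \<in> carrier L \<Longrightarrow> coord (b x (comb v)) k = (\<Sum>j<n. v j * coord (b x (e j)) k)"
    "coord (b (comb u) (comb v)) k = (\<Sum>i<n. \<Sum>j<n. u i * v j * coord (b (e i) (e j)) k)"
proof -
  show 1: "coord (b (comb u) y) k = (\<Sum>i<n. u i * coord (b (e i) y) k)" if "y \<in> carrier L" for y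
    by (rule functional_comb) (use that k in \<open>simp_all add: add smult closed coord_add coord_smult\<close>)
  show 2: "coord (b x (comb v)) k = (\<Sum>j<n. v j * coord (b x (e j)) k)" if "x \<in> carrier L" for x
    by (rule functional_comb) (use that k in \<open>simp_all add: add smult closed coord_add coord_smult\<close>)
  show "coord (b (comb u) (comb v)) k = (\<Sum>i<n. \<Sum>j<n. u i * v j * coord (b (e i) (e j)) k)"
    unfolding 1[OF comb_closed] by (simp add: 2 e_closed sum_distrib_left mult.assoc)
qed

end


section \<open>The family\<close>

text \<open>This carries identities known for positive parameters into R[z], and with that to the
  parameters \<alpha> \<le> 0.\<close>

lemma poly_eq_0_if_pos:
  fixes p :: "real poly"
  assumes "\<And>\<alpha>. \<alpha> > 0 \<Longrightarrow> poly p \<alpha> = 0"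
  shows "p = 0"
proof (rule ccontr)
  assume "p \<noteq> 0"
  then have "finite {\<alpha>. poly p \<alpha> = 0}"
    by (rule poly_roots_finite)
  moreover have "{0<..} \<subseteq> {\<alpha>. poly p \<alpha> = 0}"
    using assms by auto
  ultimately show False
    using infinite_Ioi finite_subset by blast
qed

locale symmetric_lie_basis =
  symmetric_lie g \<theta> + lie_algebra_basis g n e coord
  for g :: "(real, 'a) module" (structure) and \<theta> n e coord
begin

text \<open>The coordinates of [e_i, e_j] + (z - 1) [P e_i, P e_j], sorted by powers of z with the
  constant term first.\<close>

definition family_constants :: "nat \<Rightarrow> nat \<Rightarrow> nat \<Rightarrow> real poly" where
  "family_constants i j k =
     [: coord (e i \<otimes> e j) k - coord (odd_part (e i) \<otimes> odd_part (e j)) k,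
        coord (odd_part (e i) \<otimes> odd_part (e j)) k :]"

lemma poly_family_constants:
  "i < n \<Longrightarrow> j < n \<Longrightarrow> k < n \<Longrightarrow> poly (family_constants i j k) \<alpha> = coord (e i \<otimes>\<^bsub>deform \<alpha>\<^esub> e j) k"
  by (simp add: family_constants_def deform_bracket coord_add coord_smult e_closed bracket_closed
      algebra_simps)

lemmas coord_deform = coord_bilinear[where b = "monoid.mult (deform \<alpha>)" for \<alpha>,
    OF deform_closed deform_bilinear]

lemma structure_constants_family: "structure_constants n family_constants"
  unfolding structure_constants_def
proof (intro conjI allI impI)
  fix i k assume "i < n" "k < n"
  then show "family_constants i i k = 0"
    by (intro poly_eq_0_if_pos) (simp add: poly_family_constants deform_self e_closed coord_zero)
next
  fix i j k assume "i < n" "j < n" "k < n"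
  then have "family_constants i j k + family_constants j i k = 0"
    using deform_antisym[of "e i" "e j"]
    by (intro poly_eq_0_if_pos)
      (simp add: poly_family_constants deform_closed e_closed coord_uminus)
  then show "family_constants i j k = - family_constants j i k"
    by (simp add: eq_neg_iff_add_eq_0)
next
  fix i j k m assume lt: "i < n" "j < n" "k < n" "m < n"
  \<comment> \<open>Expanding the inner bracket in the basis turns the values of the quadratic sums
    into coordinates of nested deformed brackets, to which the Jacobi identity at \<alpha> > 0
    applies.\<close>
  have nested: "(\<Sum>l<n. poly (family_constants j k l) \<alpha> * poly (family_constants i l m) \<alpha>) =
      coord (e i \<otimes>\<^bsub>deform \<alpha>\<^esub> (e j \<otimes>\<^bsub>deform \<alpha>\<^esub> e k)) m" if "i < n" "j < n" "k < n" for i j k \<alpha>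
  proof -
    let ?x = "e j \<otimes>\<^bsub>deform \<alpha>\<^esub> e k"
    have "coord (e i \<otimes>\<^bsub>deform \<alpha>\<^esub> comb (coord ?x)) m = (\<Sum>l<n. coord ?x l * coord (e i \<otimes>\<^bsub>deform \<alpha>\<^esub> e l) m)"
      using that lt by (intro coord_deform(2)) (simp_all add: e_closed)
    then show ?thesis
      using that lt by (simp add: poly_family_constants comb_coord deform_closed e_closed)
  qed
  show "(\<Sum>l<n. family_constants j k l * family_constants i l m) +
      (\<Sum>l<n. family_constants k i l * family_constants j l m) +
      (\<Sum>l<n. family_constants i j l * family_constants k l m) = 0"
  proof (rule poly_eq_0_if_pos)
    fix \<alpha> :: real assume "\<alpha> > 0"
    from arg_cong[OF deform_pos_jacobi[OF this e_closed e_closed e_closed, OF lt(1-3)],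
        of "\<lambda>x. coord x m"]
    show "poly ((\<Sum>l<n. family_constants j k l * family_constants i l m) +
        (\<Sum>l<n. family_constants k i l * family_constants j l m) +
        (\<Sum>l<n. family_constants i j l * family_constants k l m)) \<alpha> = 0"
      using lt by (simp add: poly_sum nested coord_add coord_zero deform_closed e_closed)
  qed
qed

text \<open>Evaluating the coordinates at \<alpha> is a surjection onto \<open>g\<close> that takes
  the family bracket to the deformed one. By the factor theorem its kernel consists of the multiples
  of z - \<alpha>.\<close>

lemma fiber_family:
  fixes h :: "real poly \<Rightarrow> 'r::comm_ring_1"
  assumes "scalar_embedding h"
  shows "lie_isomorphic
    (fiber (coord_algebra h n (\<lambda>i j k. h (family_constants i j k))) \<alpha>) (deform \<alpha>)"
proof -
  interpret h: scalar_embedding h by fact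
  let ?s = "\<lambda>i j k. h (family_constants i j k)"
  let ?L = "coord_algebra h n ?s"
  interpret L: lie_algebra ?L
    by (rule h.lie_algebra_coord_algebra)
      (simp_all add: h.structure_constants_map structure_constants_family)
  \<comment> \<open>Coordinates live in the target of \<open>h\<close>, so they are first read back
    as real polynomials and only then evaluated.\<close>
  define \<psi> where "\<psi> v = comb (\<lambda>i. poly (inv_into UNIV h (v i)) \<alpha>)" for v
  have \<psi>: "\<psi> (\<lambda>i. h (p i)) = comb (\<lambda>i. poly (p i) \<alpha>)" for p
    by (simp add: \<psi>_def h.inj)
  have carrier: "(\<lambda>i. h (p i)) \<in> carrier ?L \<longleftrightarrow> (\<forall>i\<ge>n. p i = 0)" for p
    using inj_eq[OF h.inj, of _ 0] by (simp add: h.zero)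
  have carrierE: "\<exists>p. v = (\<lambda>i. h (p i)) \<and> (\<forall>i\<ge>n. p i = 0)" if v: "v \<in> carrier ?L" for v
  proof -
    have "v = (\<lambda>i. h (inv_into UNIV h (v i)))"
      using v by (auto simp: f_inv_into_f)
    then show ?thesis
      using v carrier by metis
  qed
  show ?thesis
  proof (rule fiber_isomorphicI[where \<psi> = \<psi>])
    show \<psi>_closed: "\<psi> \<in> carrier ?L \<rightarrow> carrier (deform \<alpha>)"
      by (simp add: \<psi>_def)
    show "\<psi> ` carrier ?L = carrier (deform \<alpha>)"
    proof (intro equalityI subsetI)
      fix x assume "x \<in> carrier (deform \<alpha>)"
      \<comment> \<open>Constant polynomials lift \<open>x\<close>; the zeros from \<open>n\<close>
        on place the lift in the carrier.\<close>
      define p where "p i = (if i < n then [:coord x i:] else 0)" for i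
      have "\<psi> (\<lambda>i. h (p i)) = comb (coord x)"
        unfolding \<psi> by (rule comb_cong) (simp add: p_def)
      also have "\<dots> = x"
        using \<open>x \<in> carrier (deform \<alpha>)\<close> by (simp add: comb_coord)
      finally have "\<psi> (\<lambda>i. h (p i)) = x" .
      moreover have "(\<lambda>i. h (p i)) \<in> carrier ?L"
        unfolding carrier by (simp add: p_def)
      ultimately show "x \<in> \<psi> ` carrier ?L"
        by blast
    qed (use \<psi>_closed in blast)
  next
    fix u v assume "u \<in> carrier ?L" "v \<in> carrier ?L"
    then obtain p q where uv: "u = (\<lambda>i. h (p i))" "v = (\<lambda>i. h (q i))"
      using carrierE by blast
    show "\<psi> (u \<oplus>\<^bsub>?L\<^esub> v) = \<psi> u \<oplus>\<^bsub>deform \<alpha>\<^esub> \<psi> v"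
      by (simp add: uv \<psi> comb_add flip: h.add)
    let ?w = "\<lambda>k. if k < n then \<Sum>i<n. \<Sum>j<n. p i * q j * family_constants i j k else 0"
    have "u \<otimes>\<^bsub>?L\<^esub> v = (\<lambda>k. h (?w k))"
      by (auto simp: uv h.sum h.mult h.zero)
    then have "\<psi> (u \<otimes>\<^bsub>?L\<^esub> v) = comb (\<lambda>k. poly (?w k) \<alpha>)"
      by (simp only: \<psi>)
    also have "\<dots> = comb (coord (\<psi> u \<otimes>\<^bsub>deform \<alpha>\<^esub> \<psi> v))"
      by (rule comb_cong) (simp add: uv \<psi> coord_deform(3) poly_sum poly_family_constants)
    also have "\<dots> = \<psi> u \<otimes>\<^bsub>deform \<alpha>\<^esub> \<psi> v"
      by (simp add: comb_coord deform_closed \<psi>_def)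
    finally show "\<psi> (u \<otimes>\<^bsub>?L\<^esub> v) = \<psi> u \<otimes>\<^bsub>deform \<alpha>\<^esub> \<psi> v" .
    show "u \<otimes>\<^bsub>?L\<^esub> v \<in> carrier ?L"
      by (rule L.bracket_closed) fact+
  next
    fix c v assume v: "v \<in> carrier ?L"
    then obtain p where p: "v = (\<lambda>i. h (p i))"
      using carrierE by blast
    have "\<psi> ([:c:] \<odot>\<^bsub>?L\<^esub> v) = \<psi> (\<lambda>i. h ([:c:] * p i))"
      by (simp only: p coord_algebra_simps h.mult)
    then show "\<psi> ([:c:] \<odot>\<^bsub>?L\<^esub> v) = c \<odot>\<^bsub>deform \<alpha>\<^esub> \<psi> v"
      unfolding \<psi> p by (simp add: comb_smult)
    show "[:c:] \<odot>\<^bsub>?L\<^esub> v \<in> carrier ?L"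
      by (rule L.smult_in_carrier[OF v])
  next
    fix v assume "v \<in> carrier ?L"
    then obtain q where v: "v = (\<lambda>i. h (q i))" "\<forall>i\<ge>n. q i = 0"
      using carrierE by blast
    show "fiber_ideal ?L \<alpha> +>\<^bsub>?L\<^esub> v = {u \<in> carrier ?L. \<psi> u = \<psi> v}"
    proof (intro equalityI subsetI)
      fix u assume "u \<in> fiber_ideal ?L \<alpha> +>\<^bsub>?L\<^esub> v"
      then obtain w where w: "w \<in> carrier ?L" "u = ([:- \<alpha>, 1:] \<odot>\<^bsub>?L\<^esub> w) \<oplus>\<^bsub>?L\<^esub> v"
        by (auto simp: a_r_coset_def' fiber_ideal_def simp del: coord_algebra_simps)
      obtain r where r: "w = (\<lambda>i. h (r i))" "\<forall>i\<ge>n. r i = 0"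
        using carrierE[OF w(1)] by blast
      have u: "u = (\<lambda>i. h ([:- \<alpha>, 1:] * r i + q i))"
        by (simp only: w(2) r(1) v(1) coord_algebra_simps h.mult h.add)
      then have "u \<in> carrier ?L"
        using carrier[of "\<lambda>i. [:- \<alpha>, 1:] * r i + q i"] r(2) v(2) by simp
      moreover have "\<psi> u = \<psi> v"
        unfolding u v(1) \<psi> by simp
      ultimately show "u \<in> {u \<in> carrier ?L. \<psi> u = \<psi> v}"
        by blast
    next
      fix u assume "u \<in> {u \<in> carrier ?L. \<psi> u = \<psi> v}"
      then have u': "u \<in> carrier ?L" "\<psi> u = \<psi> v"
        by blast+
      obtain p where u: "u = (\<lambda>i. h (p i))" "\<forall>i\<ge>n. p i = 0"
        using carrierE[OF u'(1)] by blast
      \<comment> \<open>The factor theorem in each coordinate. The quotients have to vanish from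
        \<open>n\<close> on for them to form an element of the carrier.\<close>
      have "\<exists>r. p i = [:- \<alpha>, 1:] * r + q i \<and> (i \<ge> n \<longrightarrow> r = 0)" for i
      proof (cases "i < n")
        case True
        then have "poly (p i - q i) \<alpha> = 0"
          using u'(2) unfolding u(1) v(1) \<psi> by (simp add: comb_eq_iff)
        then obtain r where "p i - q i = [:- \<alpha>, 1:] * r"
          unfolding poly_eq_0_iff_dvd by (rule dvdE)
        then show ?thesis
          using True by (metis diff_add_cancel not_le)
      qed (use u(2) v(2) in simp)
      then obtain r where r: "\<And>i. p i = [:- \<alpha>, 1:] * r i + q i" "\<forall>i\<ge>n. r i = 0"
        by metis
      have "(\<lambda>i. h (r i)) \<in> carrier ?L"
        using carrier[of r] r(2) by blast
      moreover have "u = ([:- \<alpha>, 1:] \<odot>\<^bsub>?L\<^esub> (\<lambda>i. h (r i))) \<oplus>\<^bsub>?L\<^esub> v"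
        unfolding u(1) v(1) r(1) coord_algebra_simps h.add h.mult ..
      ultimately show "u \<in> fiber_ideal ?L \<alpha> +>\<^bsub>?L\<^esub> v"
        by (auto simp: a_r_coset_def' fiber_ideal_def simp del: coord_algebra_simps)
    qed
  qed
qed

end

section \<open>Real polynomials among complex ones, conjugation, and the real form\<close>

lemma scalar_embedding_map_poly:
  assumes "scalar_embedding f"
  shows "scalar_embedding (map_poly f)"
proof -
  interpret f: scalar_embedding f by fact
  have coeff: "coeff (map_poly f p) i = f (coeff p i)" for p i
    by (rule coeff_map_poly) (rule f.zero)
  show ?thesis
  proof
    show "map_poly f (p + q) = map_poly f p + map_poly f q" for p q
      by (simp add: poly_eq_iff coeff f.add)
    show "map_poly f (p * q) = map_poly f p * map_poly f q" for p q
      by (simp add: poly_eq_iff coeff coeff_mult f.sum f.mult)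
    show "map_poly f 1 = 1"
      by (simp add: f.one)
    show "inj (map_poly f)"
      using f.inj by (auto simp: inj_def poly_eq_iff coeff)
  qed
qed

lemma scalar_embedding_of_real: "scalar_embedding complex_of_real"
  by unfold_locales (auto simp: inj_def)

lemma scalar_embedding_cnj: "scalar_embedding cnj"
  by unfold_locales (auto simp: inj_def)

lemma scalar_embedding_id: "scalar_embedding (\<lambda>x. x)"
  by unfold_locales (auto simp: inj_def)

lemma map_poly_cnj_eq_iff: "map_poly cnj p = p \<longleftrightarrow> p \<in> range (map_poly complex_of_real)"
proof
  assume "map_poly cnj p = p"
  then have "cnj (coeff p i) = coeff p i" for i
    by (metis coeff_map_poly complex_cnj_zero)
  then have "p = map_poly complex_of_real (map_poly Re p)"
    by (simp add: poly_eq_iff coeff_map_poly complex_eq_iff)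
  then show "p \<in> range (map_poly complex_of_real)"
    by blast
qed (auto simp: poly_eq_iff coeff_map_poly)

text \<open>An equality of records, not merely an isomorphism: conjugation fixes a coordinate
  exactly when it comes from a real polynomial, and this is how \<open>coord_algebra\<close>
  confines its carrier.\<close>

lemma real_family_coord_algebra:
  "real_family (coord_algebra (\<lambda>x. x) n s) (\<lambda>v i. map_poly cnj (v i)) =
    coord_algebra (map_poly complex_of_real) n s"
  by (auto simp: real_family_def fixed_subalgebra_def restrict_scalars_def coord_algebra_def
      fun_eq_iff map_poly_cnj_eq_iff)

text \<open>Real structure constants are fixed by conjugation, so conjugating the coordinates of two
  factors conjugates those of their bracket.\<close>

lemma antiholomorphic_involution_coord_algebra:
  assumes "\<And>i j k. s i j k \<in> range (map_poly complex_of_real)"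
  shows "antiholomorphic_involution (coord_algebra (\<lambda>x. x) n s) (\<lambda>v i. map_poly cnj (v i))"
proof -
  interpret cnj: scalar_embedding "map_poly cnj"
    by (intro scalar_embedding_map_poly scalar_embedding_cnj)
  have "map_poly cnj (s i j k) = s i j k" for i j k
    using assms by (simp add: map_poly_cnj_eq_iff)
  moreover have "map_poly cnj (map_poly complex_of_real q) = map_poly complex_of_real q" for q
    by (simp add: map_poly_cnj_eq_iff)
  moreover have "map_poly cnj (map_poly cnj p) = p" for p
    by (simp add: poly_eq_iff coeff_map_poly)
  ultimately show ?thesis
    by (auto simp: antiholomorphic_involution_def lie_hom_def restrict_scalars_def
        cnj.add cnj.mult cnj.sum cnj.zero)
qed

theorem theorem5p1:
  fixes g :: "(real, 'a) module" and \<theta> :: "'a \<Rightarrow> 'a"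
  assumes "symmetric_lie_algebra g \<theta>"
    and "finite_free g"
  shows "\<exists>(G :: (complex poly, nat \<Rightarrow> complex poly) module) \<sigma>.
    algebraic_family G \<and>
    antiholomorphic_involution G \<sigma> \<and>
    algebraic_family (real_family G \<sigma>) \<and>
    (\<forall>\<alpha>::real.
       (\<alpha> < 0 \<longrightarrow> lie_isomorphic (fiber (real_family G \<sigma>) \<alpha>) (dual_real_form g \<theta>)) \<and>
       (\<alpha> = 0 \<longrightarrow> lie_isomorphic (fiber (real_family G \<sigma>) \<alpha>) (symmetric_semidirect g \<theta>)) \<and>
       (\<alpha> > 0 \<longrightarrow> lie_isomorphic (fiber (real_family G \<sigma>) \<alpha>) g))"
proof -
  have "lie_algebra g"
    using assms(1) by (simp add: symmetric_lie_algebra_def)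
  then obtain n e coord where "lie_algebra_basis g n e coord"
    using lie_algebra.finite_free_basis assms(2) by blast
  then interpret symmetric_lie_basis g \<theta> n e coord
    using assms(1)
    by (simp add: symmetric_lie_basis_def symmetric_lie_def symmetric_lie_axioms_def
        symmetric_lie_algebra_def lie_iso_def)
  let ?h = "map_poly complex_of_real"
  let ?s = "\<lambda>i j k. ?h (family_constants i j k)"
  let ?G = "coord_algebra (\<lambda>x. x) n ?s" and ?\<sigma> = "\<lambda>v i. map_poly cnj (v i)"
  interpret id: scalar_embedding "\<lambda>x :: complex poly. x"
    by (rule scalar_embedding_id)
  interpret h: scalar_embedding ?h
    by (intro scalar_embedding_map_poly scalar_embedding_of_real)
  have s: "structure_constants n ?s"
    by (rule h.structure_constants_map[OF structure_constants_family])
  \<comment> \<open>One computation covers every real \<alpha>; what remains is to recognize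
    \<open>deform \<alpha>\<close> according to the sign.\<close>
  have fiber: "lie_isomorphic (fiber (real_family ?G ?\<sigma>) \<alpha>) (deform \<alpha>)" for \<alpha>
    unfolding real_family_coord_algebra by (rule fiber_family) (rule h.scalar_embedding_axioms)
  show ?thesis
  proof (intro exI conjI allI impI)
    show "algebraic_family ?G"
      unfolding algebraic_family_def
      using id.lie_algebra_coord_algebra[OF s] id.finite_free_coord_algebra by simp
    show "antiholomorphic_involution ?G ?\<sigma>"
      by (rule antiholomorphic_involution_coord_algebra) simp
    show "algebraic_family (real_family ?G ?\<sigma>)"
      unfolding algebraic_family_def real_family_coord_algebra
      using h.lie_algebra_coord_algebra[OF s] h.finite_free_coord_algebra by simp
  next
    fix \<alpha> :: real assume "\<alpha> < 0"
    then show "lie_isomorphic (fiber (real_family ?G ?\<sigma>) \<alpha>) (dual_real_form g \<theta>)"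
      using lie_isomorphic_trans[OF fiber] deform_neg_iso[of "sqrt (- \<alpha>)" \<alpha>]
      by (auto simp: lie_isomorphic_def)
  next
    fix \<alpha> :: real assume "\<alpha> = 0"
    then show "lie_isomorphic (fiber (real_family ?G ?\<sigma>) \<alpha>) (symmetric_semidirect g \<theta>)"
      using lie_isomorphic_trans[OF fiber] deform_zero_iso
      by (auto simp: lie_isomorphic_def)
  next
    fix \<alpha> :: real assume "\<alpha> > 0"
    then show "lie_isomorphic (fiber (real_family ?G ?\<sigma>) \<alpha>) g"
      using lie_isomorphic_trans[OF fiber] deform_pos_iso[of "sqrt \<alpha>" \<alpha>]
      by (auto simp: lie_isomorphic_def)
  qed
qed

end
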